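(* Let $n\ge 6$ and let $\Gamma$ be an unbalanced signed graph of order $n$ that contains no negative cycle of length $3$ and no negative cycle of length $4$ (as signed subgraphs). Then \[ \rho(\Gamma)\le \gamma_n, \] where $\gamma_n$ is the largest root of $\lambda^3-(n-6)\lambda^2-3(n-4)\lambda-n+3=0$, with equality if and only if $\Gamma$ is switching isomorphic to $\Gamma_n$.
   Context: A signed graph $\Gamma=(G,\sigma)$ is a simple graph $G$ with a map $\sigma:E(G)\to\{-1,1\}$. Its adjacency matrix $A(\Gamma)=(a_{uv})$ has $a_{uv}=\sigma(uv)$ if $u,v$ are adjacent and $0$ otherwise; its eigenvalues are those of $A(\Gamma)$, and its spectral radius $\rho(\Gamma)$ is the largest absolute value of an eigenvalue. A cycle is negative if it contains an odd number of negative edges, positive otherwise; $\Gamma$ is balanced if every cycle is positive, and unbalanced otherwise. For $\emptyset\ne U\subsetneq V(\Gamma)$, switching at $U$ reverses the sign of every edge between $U$ and $V(\Gamma)\setminus U$; two signed graphs are switching equivalent if one is obtained from the other by such an operation, and switching isomorphic if one is switching equivalent to an isomorphic copy of the other. For $n\ge 5$, $\Gamma_n$ is the signed graph obtained from a complete graph $K_{n-2}$ by deleting one edge $uw$, adding two new vertices $v_1,v_2$ and the three edges $v_1v_2$, $v_1u$, $v_2w$, where $v_1v_2$ is the only negative edge and all other edges are positive. *)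

theory Defs
  imports "Jordan_Normal_Form.Spectral_Radius" "HOL-Computational_Algebra.Polynomial"
begin

text \<open>A signed graph of order n on the vertex set {0..<n}, given by its signed
adjacency function: S u v = sigma(uv) if u,v adjacent, 0 otherwise.\<close>
definition signed_graph :: "nat \<Rightarrow> (nat \<Rightarrow> nat \<Rightarrow> int) \<Rightarrow> bool" where
  "signed_graph n S \<longleftrightarrow>
     (\<forall>u v. S u v \<in> {-1, 0, 1}) \<and> (\<forall>u v. S u v = S v u) \<and> (\<forall>u. S u u = 0) \<and>
     (\<forall>u v. S u v \<noteq> 0 \<longrightarrow> u < n \<and> v < n)"

definition adj_mat :: "nat \<Rightarrow> (nat \<Rightarrow> nat \<Rightarrow> int) \<Rightarrow> complex mat" where
  "adj_mat n S = mat n n (\<lambda>(i, j). of_int (S i j))"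

definition sg_spectral_radius :: "nat \<Rightarrow> (nat \<Rightarrow> nat \<Rightarrow> int) \<Rightarrow> real" where
  "sg_spectral_radius n S = spectral_radius (adj_mat n S)"

definition is_cycle :: "nat \<Rightarrow> (nat \<Rightarrow> nat \<Rightarrow> int) \<Rightarrow> nat list \<Rightarrow> bool" where
  "is_cycle n S cs \<longleftrightarrow> length cs \<ge> 3 \<and> distinct cs \<and> set cs \<subseteq> {0..<n} \<and>
     (\<forall>i < length cs. S (cs ! i) (cs ! ((i + 1) mod length cs)) \<noteq> 0)"

definition cycle_sign :: "(nat \<Rightarrow> nat \<Rightarrow> int) \<Rightarrow> nat list \<Rightarrow> int" where
  "cycle_sign S cs = (\<Prod>i < length cs. S (cs ! i) (cs ! ((i + 1) mod length cs)))"

definition negative_cycle :: "nat \<Rightarrow> (nat \<Rightarrow> nat \<Rightarrow> int) \<Rightarrow> nat list \<Rightarrow> bool" where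
  "negative_cycle n S cs \<longleftrightarrow> is_cycle n S cs \<and> cycle_sign S cs = -1"

definition balanced :: "nat \<Rightarrow> (nat \<Rightarrow> nat \<Rightarrow> int) \<Rightarrow> bool" where
  "balanced n S \<longleftrightarrow> (\<forall>cs. is_cycle n S cs \<longrightarrow> cycle_sign S cs = 1)"

definition switching_isomorphic :: "nat \<Rightarrow> (nat \<Rightarrow> nat \<Rightarrow> int) \<Rightarrow> (nat \<Rightarrow> nat \<Rightarrow> int) \<Rightarrow> bool" where
  "switching_isomorphic n S T \<longleftrightarrow>
     (\<exists>p \<theta>. bij_betw p {0..<n} {0..<n} \<and> (\<forall>i. \<theta> i \<in> {-1, 1::int}) \<and>
        (\<forall>i < n. \<forall>j < n. T (p i) (p j) = \<theta> i * S i j * \<theta> j))"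

text \<open>Gamma_n: K_{n-2} on {0..n-3} minus edge u w (u = 0, w = 1), new vertices
v1 = n-2, v2 = n-1, edges v1 v2 (negative), v1 u, v2 w (positive).\<close>
definition Gamma_n :: "nat \<Rightarrow> nat \<Rightarrow> nat \<Rightarrow> int" where
  "Gamma_n n u v =
     (if u < n - 2 \<and> v < n - 2 \<and> u \<noteq> v \<and> {u, v} \<noteq> {0, 1} then 1
      else if {u, v} = {n - 2, n - 1} then -1
      else if {u, v} = {n - 2, 0} then 1
      else if {u, v} = {n - 1, 1} then 1
      else 0)"

definition gamma_n :: "nat \<Rightarrow> real" where
  "gamma_n n = Max {x :: real. x ^ 3 - (real n - 6) * x ^ 2 - 3 * (real n - 4) * x - real n + 3 = 0}"

end

theory Submission
  imports Defs
begin

text \<open>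
  Let x be an eigenvector. After switching, x is nonnegative, and among the switchings that do not
  decrease the quadratic form of x we take one with the largest sum of entries. Then every negative
  edge across a cut is accompanied by a positive one. Since the graph is unbalanced, a negative edge
  v1 v2 survives; let A and B be the positive neighbourhoods of v1 and v2 and C the remaining vertices.
  The cut property makes A, B, C nonempty, and since triangles and quadrangles are positive, A and B
  are disjoint with no positive edge between them. So the form is dominated by that of the
  graph on these parts with all other positive edges present. Minimising out all but the sums over A and B
  leaves a binary form whose determinant is a sum of positive multiples of (a + b - 2)(c - 1) and
  (a - 1)(b - 1), where a, b, c are the cardinalities; this gives the bound, and on nonnegative vectors equality forces a = b = 1, which is Gamma_n.

  For the least eigenvalue, after switching the eigenvector to be nonnegative, the negative edges form
  a triangle-free graph, whose spectral radius squared is at most n^2/4 < gamma_n^2 for n > 6. For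
  n = 6 it is at most the number of edges of that graph, which is at most 7 as one finds an unbalanced
  pentagon or a bare hexagon.
\<close>

section \<open>A quadratic form in five variables\<close>

text \<open>Two choices need a reason. The switching is selected by its sum of entries and not by
  the value of the form, because an eigenvector may vanish at some vertices, and a form blind to
  them says nothing about their edges. With the sum as criterion the cut property holds for every
  vertex set, and the same lemma applied to the zero vector gives the purely combinatorial
  information used for n = 6.

  The constants come from rewriting the cubic: for \<open>l = gamma_n n\<close> it reads n - 2 = l +
  1 + e with e = 2l/(l^2 + 3l + 1), and e is exactly the excess at which the binary form becomes
  singular for a = b = 1. The determinant also vanishes for c = 1 together with a = 1 or b = 1.
  Those parts describe Gamma_n again, switched so that the negative edge meets the large
  near-clique; there the null vector has entries of both signs, so it is the nonnegativity of the
  vector that rules them out.\<close>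

text \<open>The determinant is that of the binary form left after minimisation. When a + b + c = l +
  1 + e, the factor \<open>l + e - a - b\<close> is \<open>c - 1\<close>, so both terms on the right
  are nonnegative as soon as \<open>m * d \<le> 2\<close>. The multiplier on the left is positive
  and clears denominators.\<close>

lemma det_identity:
  fixes l a b :: real
  assumes l: "l \<ge> 2" and ab: "a \<ge> 1" "b \<ge> 1"
  defines "e \<equiv> 2 * l / (l^2 + 3 * l + 1)"
  defines "d \<equiv> a + b - e" and "k \<equiv> l / ((l^2 - 1) * (l + 1))" and "m \<equiv> l / (l + 1)^2"
  assumes d: "d > 0"
  shows "((1/a - 1/d - k) * (1/b - 1/d - k) - (1/d - l * k)^2) * (a * b * d * (l - 1) / m) =
    (1 + l / (l + 1)) * (a + b - 2) * (l + e - a - b) + (a - 1) * (b - 1) * (l + 1) * (2 - m * d)"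
proof -
  have nz: "l - 1 \<noteq> 0" "l + 1 \<noteq> 0" "l \<noteq> 0" "a \<noteq> 0" "b \<noteq> 0" "d \<noteq> 0" "l^2 + 3 * l + 1 \<noteq> 0" "m \<noteq> 0"
    using l ab d add_pos_pos[of "l^2" "3 * l + 1"] unfolding m_def by auto
  have mk: "k = m / (l - 1)"
    using nz unfolding k_def m_def by (simp add: field_simps power2_eq_square)
  have em: "e / m = 2 * (l+1)^2 / (l^2 + 3 * l + 1)"
    using nz unfolding e_def m_def by (simp add: divide_simps)
  \<comment> \<open>The value of \<open>e\<close> enters here: the left side is a quadratic
    polynomial in \<open>a + b\<close>, and this \<open>e\<close> makes 2 one of its roots.\<close>
  have s: "(a + b - 1) * (l + 1) * (2 - m * d) - e / m * (l - 1) - (a + b) * d =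
      (1 + l / (l + 1)) * (a + b - 2) * (l + e - a - b)"
  proof -
    have m': "m * (l + 1) = l / (l + 1)" using nz unfolding m_def by (simp add: field_simps power2_eq_square)
    have "(a + b - 1) * (l + 1) * (2 - m * d) = (a + b - 1) * (2 * (l + 1) - l / (l + 1) * d)"
      unfolding m'[symmetric] by (simp add: algebra_simps)
    moreover have "(a + b - 1) * (2 * (l + 1) - l / (l + 1) * (a + b - e)) - 2 * (l+1)^2 / (l^2 + 3 * l + 1) * (l - 1) - (a + b) * (a + b - e) =
      (1 + l / (l + 1)) * (a + b - 2) * (l + e - a - b)"
      using nz unfolding e_def by (simp add: divide_simps) (simp add: power2_eq_square algebra_simps)?
    ultimately show ?thesis by (simp only: em d_def times_divide_eq_left)
  qed
  \<comment> \<open>The squares combine as a difference: \<open>(1/d + k)^2 - (1/d - l * k)^2 = (l +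
    1) * k * (2/d - (l - 1) * k)\<close>. The rest simplifies through
    \<open>d - (a + b) = - e\<close>.\<close>
  have D: "((1/a - 1/d - k) * (1/b - 1/d - k) - (1/d - l * k)^2) * (a * b * d) =
     (l + 1) * k * (2 - (l - 1) * k * d) * (a * b) - (e + (a + b) * k * d)"
    using nz unfolding d_def[symmetric]
  proof -
    have e: "e = a + b - d" unfolding d_def by simp
    show ?thesis unfolding e using nz by (simp add: divide_simps) (simp add: power2_eq_square algebra_simps)?
  qed
  have k': "(l - 1) * k = m" using nz mk by simp
  have "((1/a - 1/d - k) * (1/b - 1/d - k) - (1/d - l * k)^2) * (a * b * d * (l - 1) / m) =
     (((1/a - 1/d - k) * (1/b - 1/d - k) - (1/d - l * k)^2) * (a * b * d)) * ((l - 1) / m)" by simp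
  also have "\<dots> = (l + 1) * (2 - m * d) * (a * b) - (e / m * (l - 1) + (a + b) * d)"
  proof -
    have km: "k * ((l - 1) / m) = 1" unfolding mk using nz by simp
    have *: "((l + 1) * k * t * (a * b) - (e + (a + b) * k * d)) * w =
      (l + 1) * t * (a * b) * (k * w) - (e * w + (a + b) * d * (k * w))" for w t
      by (simp add: algebra_simps)
    show ?thesis unfolding D k' * km by simp
  qed
  also have "\<dots> = (a + b - 1) * (l + 1) * (2 - m * d) - e / m * (l - 1) - (a + b) * d +
     (a - 1) * (b - 1) * (l + 1) * (2 - m * d)" by (simp add: algebra_simps)
  finally show ?thesis unfolding s .
qed

text \<open>Here \<open>A\<close>, \<open>B\<close>, \<open>X\<close> play the sums of a vector over
  parts of sizes \<open>a\<close>, \<open>b\<close>, \<open>c\<close>, and \<open>y\<close>,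
  \<open>z\<close> its entries at v1 and v2. The left side is l times the squared norm minus the
  form, for a vector constant on each part. Squares are completed in \<open>y\<close>, then
  \<open>z\<close>, then \<open>X\<close>; eliminating \<open>y\<close> and \<open>z\<close>
  produces \<open>k\<close>, eliminating \<open>X\<close> produces \<open>d\<close>.\<close>

lemma reduce_identity:
  fixes l a b c A B X y z :: real
  assumes l: "l \<ge> 2" and ab: "a \<ge> 1" "b \<ge> 1" "c \<ge> 1"
  defines "k \<equiv> l / ((l^2 - 1) * (l + 1))"
  defines "d \<equiv> l + 1 - c"
  assumes d: "d > 0"
  shows "(l + 1) * (A^2 / a + B^2 / b + X^2 / c) + l * (y^2 + z^2) - (A + B + X)^2 + 2 * (A - z) * (B - y)
   = (l * y + z - A)^2 / l + (l - 1/l) * (z - (l * B - A) / (l^2 - 1))^2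
     + d / c * (X - c * (A + B) / d)^2
     + (l + 1) * ((1/a - 1/d - k) * A^2 + (1/b - 1/d - k) * B^2 - 2 * (1/d - l * k) * A * B)"
proof -
  have l1: "l^2 - 1 \<noteq> 0" using l by (simp add: power2_eq_1_iff)
  have nz: "l - 1 \<noteq> 0" "l + 1 \<noteq> 0" "l \<noteq> 0" "a \<noteq> 0" "b \<noteq> 0" "c \<noteq> 0" "d \<noteq> 0"
    using l ab d by auto
  have 1: "(l * y + z - A)^2 / l + (l - 1/l) * (z - (l * B - A) / (l^2 - 1))^2
     = l * (y^2 + z^2) + 2 * y * z - 2 * y * A - 2 * z * B + (l * (A^2 + B^2) - 2 * A * B) / (l^2 - 1)"
  proof -
    have e: "(l - 1/l) = (l^2 - 1) / l" using nz by (simp add: field_simps power2_eq_square)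
    have "(l - 1/l) * (z - (l * B - A) / (l^2 - 1))^2 = ((l^2 - 1) * z - (l * B - A))^2 / (l * (l^2 - 1))"
    proof -
      have w: "z - (l * B - A) / (l^2 - 1) = ((l^2 - 1) * z - (l * B - A)) / (l^2 - 1)"
        using l1 by (simp add: diff_divide_distrib)
      show ?thesis unfolding e w power_divide using nz l1 by (simp add: power2_eq_square)
    qed
    also have "(l * y + z - A)^2 / l + \<dots> = l * (y^2 + z^2) + 2 * y * z - 2 * y * A - 2 * z * B + (l * (A^2 + B^2) - 2 * A * B) / (l^2 - 1)"
      using nz l1 by (simp add: divide_simps) (simp add: power2_eq_square algebra_simps)?
    finally show ?thesis .
  qed
  have 2: "d / c * (X - c * (A + B) / d)^2 = (l + 1) * X^2 / c - (A + B + X)^2 + (l + 1) * (A + B)^2 / d"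
  proof -
    have l': "l + 1 = d + c" unfolding d_def by simp
    have "(X - c * (A + B) / d)^2 = (d * X - c * (A + B))^2 / d^2"
      using nz by (simp add: divide_simps mult.commute)
    then show ?thesis unfolding l' using nz by (simp add: divide_simps) (simp add: power2_eq_square algebra_simps)?
  qed
  have 3: "(l + 1) * k = l / (l^2 - 1)" using nz l1 unfolding k_def by (simp add: divide_simps)
  have 4: "(l + 1) * ((1/a - 1/d - k) * A^2 + (1/b - 1/d - k) * B^2 - 2 * (1/d - l * k) * A * B)
    = (l + 1) * (A^2/a + B^2/b) - (l + 1) * (A + B)^2 / d - (l + 1) * k * (A^2 + B^2 - 2 * l * A * B)"
    using nz by (simp add: divide_simps) (simp add: power2_eq_square algebra_simps)?
  show ?thesis unfolding 1 2 4 3 using l1 by (simp add: divide_simps) (simp add: power2_eq_square algebra_simps)?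
qed

text \<open>The estimate \<open>e \<le> 1 / 2\<close> carries the signs: it keeps
  \<open>d = a + b - e\<close> well above the smaller of \<open>a\<close> and \<open>b\<close>, so
  the diagonal coefficient of the smaller part is positive. The determinant facts come from
  \<open>det_identity\<close>, whose two terms are separately nonnegative and hence both vanish at
  equality.\<close>

lemma form_coeffs_aux:
  fixes l a b c :: real
  assumes l: "l \<ge> 2" and ab: "a \<ge> 1" "b \<ge> 1" "c \<ge> 1"
  defines "e \<equiv> 2 * l / (l^2 + 3 * l + 1)"
  assumes n: "a + b + c = l + 1 + e"
  defines "d \<equiv> l + 1 - c" and "k \<equiv> l / ((l^2 - 1) * (l + 1))"
  shows "0 < d" "d \<le> l" "k > 0" "l * k < 1 / l" "l * k < 1 / d" "e \<le> 1 / 2" "0 < e"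
    and "a \<le> b \<Longrightarrow> 1/a - 1/d - k > 0"
    and "(1/a - 1/d - k) * (1/b - 1/d - k) \<ge> (1/d - l * k)^2"
    and "(1/a - 1/d - k) * (1/b - 1/d - k) = (1/d - l * k)^2 \<Longrightarrow> (a - 1) * (b - 1) = 0 \<and> (a + b - 2) * (c - 1) = 0"
proof -
  have ll: "l^2 \<ge> 4" using power_mono[of 2 l 2] l by simp
  have l0: "l > 0" using l by simp
  have L: "l^2 + 3 * l + 1 > 0" using ll l by linarith
  show e0: "0 < e" using L l0 unfolding e_def by simp
  show e2: "e \<le> 1 / 2"
  proof -
    have "1 * l \<le> l * l" by (rule mult_right_mono) (use l in auto)
    then have "4 * l \<le> l^2 + 3 * l + 1" unfolding power2_eq_square by linarith
    then show ?thesis using L unfolding e_def by (simp add: divide_simps)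
  qed
  have d: "d = a + b - e" using n unfolding d_def by simp
  show d0: "d > 0" using d ab e2 by simp
  show dl: "d \<le> l" unfolding d_def using ab by simp
  have w: "l^2 - 1 > 0" using ll by simp
  show k0: "k > 0" unfolding k_def using w l0 by simp
  show kl: "l * k < 1 / l"
  proof -
    have "l + 1 < l^2" using mult_mono[of 2 l l l] l unfolding power2_eq_square by linarith
    then have "l * l * l < (l^2 - 1) * (l + 1)" by (simp add: algebra_simps power2_eq_square)
    then show ?thesis unfolding k_def using w l0 by (simp add: divide_simps mult.assoc)
  qed
  have dl': "1 / l \<le> 1 / d" using dl d0 l0 by (simp add: divide_simps)
  show kd: "l * k < 1 / d" using kl dl' by simp
  show "1/a - 1/d - k > 0" if le: "a \<le> b"
  proof -
    have "k < 1 / (l * d)" using kd l0 d0 by (simp add: divide_simps mult.commute mult.left_commute)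
    then have "1 / d + k < 1 / d + 1 / (l * d)" by simp
    also have "\<dots> = (1 + 1 / l) / d" using l0 d0 by (simp add: divide_simps)
    \<comment> \<open>From \<open>b \<ge> a \<ge> 1\<close> and \<open>e \<le> 1 / 2\<close> follows
      \<open>d \<ge> a + a / 2\<close>, while \<open>l \<ge> 2\<close> gives
      \<open>a / l \<le> a / 2\<close>.\<close>
    also have "\<dots> \<le> 1 / a"
    proof -
      have "a / l \<le> a / 2" using l ab by (intro divide_left_mono) auto
      moreover have "a * (1 + 1 / l) = a + a / l" by (simp add: distrib_left)
      ultimately have "a * (1 + 1 / l) \<le> d" unfolding d using ab e2 le by linarith
      then show ?thesis using d0 ab by (simp add: pos_divide_le_eq pos_le_divide_eq mult.commute)
    qed
    finally show ?thesis by simp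
  qed
  define m where "m = l / (l+1)^2"
  have m0: "m > 0" using l0 unfolding m_def by simp
  have md: "m * d < 1"
  proof -
    have "l * d \<le> l * l" using dl l0 by simp
    also have "\<dots> < (l+1)^2" using l0 by (simp add: power2_eq_square algebra_simps)
    finally show ?thesis unfolding m_def using l0 by (simp add: divide_simps)
  qed
  define D where "D = (1/a - 1/d - k) * (1/b - 1/d - k) - (1/d - l * k)^2"
  have id: "D * (a * b * d * (l - 1) / m) =
    (1 + l / (l + 1)) * (a + b - 2) * (c - 1) + (a - 1) * (b - 1) * (l + 1) * (2 - m * d)"
  proof -
    have c: "c - 1 = l + e - a - b" using n by simp
    show ?thesis using det_identity[OF l ab(1,2)] d0
      unfolding D_def c d e_def m_def k_def by simp
  qed
  have t: "a * b * d * (l - 1) / m > 0" using ab d0 l m0 by simp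
  have p1: "(1 + l / (l + 1)) * ((a + b - 2) * (c - 1)) \<ge> 0" using ab l by simp
  have p2: "((a - 1) * (b - 1)) * ((l + 1) * (2 - m * d)) \<ge> 0" using ab l md by simp
  have "D * (a * b * d * (l - 1) / m) \<ge> 0" unfolding id using p1 p2 by (simp add: mult.assoc)
  then have "D \<ge> 0" using t zero_le_mult_iff[of D "a * b * d * (l - 1) / m"] by linarith
  then show "(1/a - 1/d - k) * (1/b - 1/d - k) \<ge> (1/d - l * k)^2" unfolding D_def by simp
  show "(a - 1) * (b - 1) = 0 \<and> (a + b - 2) * (c - 1) = 0"
    if "(1/a - 1/d - k) * (1/b - 1/d - k) = (1/d - l * k)^2"
  proof -
    have "D = 0" unfolding D_def using that by simp
    then have "(1 + l / (l + 1)) * ((a + b - 2) * (c - 1)) + ((a - 1) * (b - 1)) * ((l + 1) * (2 - m * d)) = 0"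
      using id by (simp add: mult.assoc)
    then have "(1 + l / (l + 1)) * ((a + b - 2) * (c - 1)) = 0" "((a - 1) * (b - 1)) * ((l + 1) * (2 - m * d)) = 0"
      using p1 p2 by linarith+
    moreover have "1 + l / (l + 1) > 0" "(l + 1) * (2 - m * d) > 0" using l md by (auto intro: add_pos_pos)
    ultimately show ?thesis by auto
  qed
qed

text \<open>One coefficient, that of the smaller part, is positive by a direct estimate. The product
  of both is at least the positive number \<open>(1/d - l * k)^2\<close>, so the other has the same
  sign.\<close>

lemma form_coeffs:
  fixes l a b c :: real
  assumes l: "l \<ge> 2" and ab: "a \<ge> 1" "b \<ge> 1" "c \<ge> 1"
  assumes n: "a + b + c = l + 1 + 2 * l / (l^2 + 3 * l + 1)"
  defines "d \<equiv> l + 1 - c" and "k \<equiv> l / ((l^2 - 1) * (l + 1))"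
  shows "1/a - 1/d - k > 0" "1/b - 1/d - k > 0"
proof -
  have r: "1/d - l * k > 0" using form_coeffs_aux(5)[OF l ab n] unfolding d_def k_def by simp
  have D: "(1/a - 1/d - k) * (1/b - 1/d - k) \<ge> (1/d - l * k)^2"
    using form_coeffs_aux(9)[OF l ab n] unfolding d_def k_def by simp
  have pq: "(1/a - 1/d - k) * (1/b - 1/d - k) > 0" using D r zero_less_power[OF r, of 2] by linarith
  have n': "b + a + c = l + 1 + 2 * l / (l^2 + 3 * l + 1)" using n by simp
  have "1/a - 1/d - k > 0 \<or> 1/b - 1/d - k > 0"
  proof (cases "a \<le> b")
    case True
    then show ?thesis using form_coeffs_aux(8)[OF l ab n True] unfolding d_def k_def by simp
  next
    case False
    then show ?thesis using form_coeffs_aux(8)[OF l ab(2,1,3) n'] unfolding d_def k_def by simp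
  qed
  then show "1/a - 1/d - k > 0" "1/b - 1/d - k > 0" using pq by (auto simp: zero_less_mult_iff)
qed

text \<open>At equality all squares vanish, so \<open>X\<close>, \<open>y\<close>, \<open>z\<close>
  are determined by \<open>A\<close> and \<open>B\<close>, and (A, B) is a null vector of the binary
  form. The signs of \<open>y\<close> and \<open>z\<close> then decide between the singular
  cases.\<close>

lemma reduced_form_nonneg:
  fixes l a b c A B X y z :: real
  assumes l: "l \<ge> 2" and ab: "a \<ge> 1" "b \<ge> 1" "c \<ge> 1"
  assumes n: "a + b + c = l + 1 + 2 * l / (l^2 + 3 * l + 1)"
  defines "F \<equiv> (l + 1) * (A^2 / a + B^2 / b + X^2 / c) + l * (y^2 + z^2) - (A + B + X)^2 + 2 * (A - z) * (B - y)"
  shows "F \<ge> 0"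
    and "F = 0 \<Longrightarrow> A \<ge> 0 \<Longrightarrow> B \<ge> 0 \<Longrightarrow> X \<ge> 0 \<Longrightarrow> y \<ge> 0 \<Longrightarrow> z \<ge> 0 \<Longrightarrow>
      A \<noteq> 0 \<or> B \<noteq> 0 \<or> X \<noteq> 0 \<or> y \<noteq> 0 \<or> z \<noteq> 0 \<Longrightarrow>
      a = 1 \<and> b = 1 \<and> A > 0 \<and> B > 0 \<and> X > 0 \<and> y > 0 \<and> z > 0"
proof -
  define d where "d = l + 1 - c"
  define k where "k = l / ((l^2 - 1) * (l + 1))"
  note co = form_coeffs_aux[OF l ab n, folded d_def k_def]
  define p where "p = 1/a - 1/d - k"
  define q where "q = 1/b - 1/d - k"
  define r where "r = 1/d - l * k"
  have p: "p > 0" and q: "q > 0" using form_coeffs[OF l ab n] unfolding p_def q_def d_def k_def by simp_all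
  have r: "r > 0" using co(5) unfolding r_def by simp
  have D: "p * q \<ge> r^2" using co(9) unfolding p_def q_def r_def .
  define f where "f = p * A^2 + q * B^2 - 2 * r * A * B"
  have pf: "p * f = (p * A - r * B)^2 + (p * q - r^2) * B^2"
    unfolding f_def by (simp add: power2_eq_square algebra_simps)
  have "p * f \<ge> 0" unfolding pf using D by simp
  then have f0: "f \<ge> 0" using p by (simp add: zero_le_mult_iff)
  have l0: "l > 0" "l - 1/l > 0" "l\<^sup>2 - 1 > 0"
    using l mult_mono[of 2 l 2 l] by (auto simp: power2_eq_square divide_simps)
  have dc: "d / c > 0" using co(1) ab by simp
  have F: "F = (l * y + z - A)^2 / l + (l - 1/l) * (z - (l * B - A) / (l^2 - 1))^2
     + d / c * (X - c * (A + B) / d)^2 + (l + 1) * f"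
    unfolding F_def f_def p_def q_def r_def d_def k_def
    using reduce_identity[OF l ab] co(1) unfolding d_def by simp
  have s: "(l * y + z - A)^2 / l \<ge> 0" "(l - 1/l) * (z - (l * B - A) / (l^2 - 1))^2 \<ge> 0"
     "d / c * (X - c * (A + B) / d)^2 \<ge> 0" "(l + 1) * f \<ge> 0"
    using l0 f0 l mult_nonneg_nonneg[OF less_imp_le[OF dc] zero_le_power2] by simp_all
  show "F \<ge> 0" unfolding F using s by linarith
  show "a = 1 \<and> b = 1 \<and> A > 0 \<and> B > 0 \<and> X > 0 \<and> y > 0 \<and> z > 0"
    if F0: "F = 0" and nn: "A \<ge> 0" "B \<ge> 0" "X \<ge> 0" "y \<ge> 0" "z \<ge> 0"
      and nz: "A \<noteq> 0 \<or> B \<noteq> 0 \<or> X \<noteq> 0 \<or> y \<noteq> 0 \<or> z \<noteq> 0"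
  proof -
    have z: "(l * y + z - A)^2 / l = 0" "(l - 1/l) * (z - (l * B - A) / (l^2 - 1))^2 = 0"
     "d / c * (X - c * (A + B) / d)^2 = 0" "(l + 1) * f = 0"
      using F0 s unfolding F by linarith+
    have y: "l * y + z = A" using z(1) l0 by simp
    have zz: "z = (l * B - A) / (l^2 - 1)" using z(2) l0 by simp
    have z': "z * (l^2 - 1) = l * B - A" using zz l0 by simp
    have "l * (y + l * z - B) = 0" using z' unfolding y[symmetric] by (simp add: power2_eq_square algebra_simps)
    then have "B = y + l * z" using l0(1) by simp
    then have yy: "y * (l^2 - 1) = l * A - B" unfolding y[symmetric] by (simp add: power2_eq_square algebra_simps)
    have X: "X = c * (A + B) / d" using z(3) co(1) ab by simp
    have f: "f = 0" using z(4) l by simp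
    have e1: "(p * A - r * B)^2 = 0" "(p * q - r^2) * B^2 = 0"
    proof -
      have "0 \<le> (p * A - r * B)^2" "0 \<le> (p * q - r^2) * B^2" using D by simp_all
      moreover have "(p * A - r * B)^2 + (p * q - r^2) * B^2 = 0" using pf f by simp
      ultimately show "(p * A - r * B)^2 = 0" "(p * q - r^2) * B^2 = 0" by linarith+
    qed
    have pA: "p * A = r * B" using e1 by simp
    have B: "B \<noteq> 0"
    proof
      assume "B = 0"
      then have "A = 0" using pA p by simp
      with \<open>B = 0\<close> have "X = 0" "z = 0" using X zz by simp_all
      with \<open>A = 0\<close> have "y = 0" using y l by simp
      with \<open>B = 0\<close> \<open>A = 0\<close> \<open>X = 0\<close> \<open>z = 0\<close> show False using nz by simp
    qed
    then have B0: "B > 0" using nn by simp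
    then have A0: "A > 0" using zero_less_mult_pos[of p A] p mult_pos_pos[OF r B0] unfolding pA by simp
    have pq: "p * q = r^2" using e1 B by simp
    have "p * (r * A) = r * (p * A)" by simp
    also have "\<dots> = r^2 * B" unfolding pA by (simp add: power2_eq_square)
    also have "\<dots> = p * (q * B)" unfolding pq[symmetric] by simp
    finally have "p * (r * A) = p * (q * B)" .
    then have qB: "r * A = q * B" using p by simp
    \<comment> \<open>The entries \<open>y\<close> and \<open>z\<close> are positive multiples of
      \<open>l * A - B\<close> and \<open>l * B - A\<close>.\<close>
    have le: "A \<le> l * B" "B \<le> l * A"
    proof -
      have "0 \<le> z * (l^2 - 1)" "0 \<le> y * (l^2 - 1)" using nn l0 by simp_all
      then show "A \<le> l * B" "B \<le> l * A" using z' yy by simp_all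
    qed
    have one: "a = 1 \<and> b = 1"
    proof (rule ccontr)
      \<comment> \<open>In the other singular case \<open>c = 1\<close> and one of \<open>a\<close>,
        \<open>b\<close> is 1. The null vector satisfies \<open>p * A = r * B\<close> and
        \<open>r * A = q * B\<close>; since \<open>l * r\<close> is below \<open>p\<close> or
        \<open>q\<close>, one of \<open>A\<close>, \<open>B\<close> exceeds \<open>l\<close> times
        the other, and an entry at v1 or v2 would be negative.\<close>
      assume ne: "\<not> (a = 1 \<and> b = 1)"
      then have c: "c = 1" and o: "a = 1 \<or> b = 1"
        using co(10)[folded p_def q_def r_def, OF pq] ab by auto
      have d: "d = l" unfolding d_def c by simp
      \<comment> \<open>With \<open>d = l\<close> this amounts to
        \<open>(l^2 - 1) * k > 1 / l\<close>, where the left side equals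
        \<open>l / (l + 1)\<close>.\<close>
      have lr: "l * r < 1 - 1 / l - k"
      proof -
        have "(l^2 - 1) * k = l / (l + 1)" unfolding k_def using l0 by simp
        moreover have "l + 1 < l * l" using mult_right_mono[of 2 l l] l by linarith
        then have "1 / l < l / (l + 1)" using l0(1) by (simp add: divide_simps)
        ultimately show ?thesis unfolding r_def d using l0(1) by (simp add: algebra_simps power2_eq_square)
      qed
      from o show False
      proof
        assume "a = 1"
        then have "l * r < p" using lr unfolding p_def d by simp
        then have "r * B * l < p * B" using B0 by (simp add: mult.commute mult.left_commute)
        also have "\<dots> \<le> p * (l * A)" using le p by simp
        also have "\<dots> = l * (p * A)" by simp
        finally show False unfolding pA by simp
      next
        assume "b = 1"
        then have "l * r < q" using lr unfolding q_def d by simp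
        then have "r * A * l < q * A" using A0 by (simp add: mult.commute mult.left_commute)
        also have "\<dots> \<le> q * (l * B)" using le q by simp
        also have "\<dots> = l * (q * B)" by simp
        finally show False unfolding qB[symmetric] by simp
      qed
    qed
    then have "p = q" unfolding p_def q_def by simp
    then have "p = r" using pq p r power2_eq_iff[of p r] by (simp add: power2_eq_square)
    then have AB: "A = B" using pA p by simp
    have "z * (l^2 - 1) > 0" "y * (l^2 - 1) > 0" unfolding z' yy AB using B0 l by simp_all
    then have "z > 0" "y > 0" using l0 by (auto simp: zero_less_mult_iff)
    moreover have "X > 0" unfolding X using ab A0 B0 co(1) by simp
    ultimately show ?thesis using one A0 B0 by simp
  qed
qed

section \<open>The cubic defining gamma\<close>

definition gamma_poly :: "nat \<Rightarrow> real \<Rightarrow> real" where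
  "gamma_poly n x = x ^ 3 - (real n - 6) * x ^ 2 - 3 * (real n - 4) * x - real n + 3"

lemma continuous_gamma_poly: "continuous_on A (gamma_poly n)"
  unfolding gamma_poly_def by (intro continuous_intros)

lemma finite_gamma_roots: "finite {x. gamma_poly n x = 0}"
proof -
  let ?p = "[:3 - real n, - 3 * (real n - 4), - (real n - 6), 1:]"
  have "{x. gamma_poly n x = 0} = {x. poly ?p x = 0}"
    unfolding gamma_poly_def by (simp add: algebra_simps power2_eq_square power3_eq_cube)
  then show ?thesis using poly_roots_finite[of ?p] by simp
qed

lemma gamma_poly_pos:
  assumes n: "n \<ge> 6" and x: "x \<ge> real n - 3"
  shows "gamma_poly n x > 0"
proof -
  have x3: "x \<ge> 3" using assms by linarith
  have "3 * x^2 \<le> x^2 * (x - (real n - 6))" using mult_left_mono[of 3 "x - (real n - 6)" "x^2"] x by simp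
  moreover have "3 * x * (real n - 4) \<le> 3 * x * (x - 1)" using x x3 by (intro mult_left_mono) auto
  ultimately show ?thesis using x x3 unfolding gamma_poly_def
    by (simp add: algebra_simps power2_eq_square power3_eq_cube)
qed

lemma gamma_n_Max: "gamma_n n = Max {x. gamma_poly n x = 0}"
  unfolding gamma_n_def gamma_poly_def by simp

text \<open>A sign test for lower bounds on the largest root: the cubic is positive from n - 3 on,
  so a negative value has a root to its right.\<close>

lemma gamma_n_greater:
  assumes n: "n \<ge> 6" and r: "gamma_poly n r < 0"
  shows "r < gamma_n n"
proof -
  have "r < real n" using gamma_poly_pos[OF n, of r] r by linarith
  moreover have "gamma_poly n (real n) > 0" using gamma_poly_pos[OF n, of "real n"] by simp
  ultimately obtain x where x: "r \<le> x" "gamma_poly n x = 0"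
    using IVT'[of "gamma_poly n" r 0 "real n"] r continuous_gamma_poly by auto
  then have "r < x" using r by (cases "r = x") auto
  also have "x \<le> gamma_n n" unfolding gamma_n_Max using finite_gamma_roots x by simp
  finally show ?thesis .
qed

lemma gamma_n_gt:
  assumes n: "n \<ge> 6"
  shows "real n - 4 < gamma_n n"
proof (rule gamma_n_greater[OF n])
  have "gamma_poly n (real n - 4) = - ((real n - 4)^2) - real n + 3"
    unfolding gamma_poly_def by (simp add: algebra_simps power2_eq_square power3_eq_cube)
  then show "gamma_poly n (real n - 4) < 0" using n zero_le_power2[of "real n - 4"] by linarith
qed

lemma gamma_n_root:
  assumes n: "n \<ge> 6"
  shows "gamma_poly n (gamma_n n) = 0"
proof -
  have "gamma_poly n (real n - 4) = - ((real n - 4)^2) - real n + 3"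
    unfolding gamma_poly_def by (simp add: algebra_simps power2_eq_square power3_eq_cube)
  then have "gamma_poly n (real n - 4) < 0" using n zero_le_power2[of "real n - 4"] by linarith
  moreover have "gamma_poly n (real n) > 0" using gamma_poly_pos[OF n, of "real n"] by simp
  ultimately obtain x where "gamma_poly n x = 0"
    using IVT'[of "gamma_poly n" "real n - 4" 0 "real n"] continuous_gamma_poly by auto
  then show ?thesis using Max_in[OF finite_gamma_roots, of n] unfolding gamma_n_Max by blast
qed

lemma gamma_n_ge_2: "n \<ge> 6 \<Longrightarrow> gamma_n n \<ge> 2"
  using gamma_n_gt[of n] by simp

text \<open>The cubic equation is (n - 3 - l)(l^2 + 3l + 1) = 2l in disguise. In this form it fixes
  the total a + b + c of the part sizes.\<close>

lemma order_eq_gamma_n: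
  assumes n: "n \<ge> 6"
  defines "l \<equiv> gamma_n n"
  shows "real n - 2 = l + 1 + 2 * l / (l^2 + 3 * l + 1)"
proof -
  have l: "l \<ge> 2" unfolding l_def using gamma_n_ge_2[OF n] .
  have L: "l^2 + 3 * l + 1 > 0" using l by (intro add_pos_pos) auto
  have "(real n - 3 - l) * (l^2 + 3 * l + 1) = 2 * l"
    using gamma_n_root[OF n] unfolding l_def[symmetric] gamma_poly_def
    by (simp add: algebra_simps power2_eq_square power3_eq_cube)
  then have "real n - 3 - l = 2 * l / (l^2 + 3 * l + 1)" using L by (simp add: eq_divide_eq)
  then show ?thesis by simp
qed

text \<open>For n = 6 the bound n/2 for triangle-free graphs exceeds gamma_n, which is about 2.67; hence the separate 7.\<close>
lemma gamma_n_square_gt: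
  assumes n: "n \<ge> 6"
  shows "n = 6 \<Longrightarrow> 7 < gamma_n n ^ 2" "n \<ge> 7 \<Longrightarrow> real n ^ 2 / 4 < gamma_n n ^ 2"
proof -
  show "7 < gamma_n n ^ 2" if "n = 6"
  proof -
    \<comment> \<open>The number 8/3 lies just below the root, and its square 64/9 still exceeds
      7.\<close>
    have "8/3 < gamma_n n" by (rule gamma_n_greater[OF n]) (simp add: gamma_poly_def that power2_eq_square power3_eq_cube)
    from power_strict_mono[OF this, of 2] show ?thesis by (simp add: power2_eq_square)
  qed
  show "real n ^ 2 / 4 < gamma_n n ^ 2" if "n \<ge> 7"
  proof -
    have "real n / 2 < gamma_n n"
    \<comment> \<open>For n = 7 the cubic is negative at 7/2; from n = 8 on, n/2 is at most n -
      4.\<close>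
    proof (cases "n = 7")
      case True
      show ?thesis by (rule gamma_n_greater[OF n]) (simp add: gamma_poly_def True power2_eq_square power3_eq_cube)
    next
      case False
      then show ?thesis using gamma_n_gt[OF n] that by simp
    qed
    from power_strict_mono[OF this, of 2] show ?thesis by (simp add: power2_eq_square)
  qed
qed

section \<open>Real eigenpairs of the adjacency matrix\<close>

definition eigenpair :: "nat \<Rightarrow> (nat \<Rightarrow> nat \<Rightarrow> int) \<Rightarrow> real \<Rightarrow> (nat \<Rightarrow> real) \<Rightarrow> bool" where
  "eigenpair n S e x \<longleftrightarrow> (\<exists>i<n. x i \<noteq> 0) \<and> (\<forall>i<n. (\<Sum>j<n. of_int (S i j) * x j) = e * x i)"

lemma adj_mat_carrier: "adj_mat n S \<in> carrier_mat n n"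
  unfolding adj_mat_def by simp

lemma eigenvalue_adj_matI:
  assumes "eigenpair n S e x"
  shows "eigenvalue (adj_mat n S) (of_real e)"
proof -
  let ?v = "vec n (\<lambda>i. complex_of_real (x i))"
  have "adj_mat n S *\<^sub>v ?v = of_real e \<cdot>\<^sub>v ?v"
  proof (rule eq_vecI)
    fix i assume "i < dim_vec (of_real e \<cdot>\<^sub>v ?v)"
    then have i: "i < n" by simp
    have "(adj_mat n S *\<^sub>v ?v) $ i = (\<Sum>j<n. of_int (S i j) * complex_of_real (x j))"
      using i unfolding adj_mat_def by (simp add: scalar_prod_def atLeast0LessThan)
    also have "\<dots> = of_real (\<Sum>j<n. of_int (S i j) * x j)" by simp
    also have "\<dots> = of_real (e * x i)" using assms i unfolding eigenpair_def by simp
    finally show "(adj_mat n S *\<^sub>v ?v) $ i = (of_real e \<cdot>\<^sub>v ?v) $ i" using i by simp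
  qed (simp add: adj_mat_def)
  moreover have "?v \<noteq> 0\<^sub>v n"
  proof
    assume v: "?v = 0\<^sub>v n"
    obtain i where i: "i < n" "x i \<noteq> 0" using assms unfolding eigenpair_def by blast
    have "?v $ i = 0\<^sub>v n $ i" unfolding v ..
    then show False using i by simp
  qed
  ultimately have "eigenvector (adj_mat n S) ?v (of_real e)"
    unfolding eigenvector_def adj_mat_def by simp
  then show ?thesis unfolding eigenvalue_def by blast
qed

text \<open>By symmetry \<open>R\<close> is real, and \<open>R = k * N\<close> with \<open>N\<close>
  real and positive, so \<open>k\<close> is real. The eigenvector equation then splits into real and
  imaginary parts, at least one of which is nonzero.\<close>

lemma eigenvalue_adj_matE:
  assumes sym: "\<forall>i j. S i j = S j i" and ev: "eigenvalue (adj_mat n S) k"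
  obtains e x where "k = of_real e" "eigenpair n S e x"
proof -
  obtain v where v: "v \<in> carrier_vec n" "v \<noteq> 0\<^sub>v n" "adj_mat n S *\<^sub>v v = k \<cdot>\<^sub>v v"
    using ev unfolding eigenvalue_def eigenvector_def adj_mat_def by auto
  have eq: "(\<Sum>j<n. of_int (S i j) * v $ j) = k * v $ i" if i: "i < n" for i
  proof -
    have "(adj_mat n S *\<^sub>v v) $ i = (\<Sum>j<n. of_int (S i j) * v $ j)"
      using i v(1) unfolding adj_mat_def by (auto simp: scalar_prod_def atLeast0LessThan)
    then show ?thesis using i v by simp
  qed
  obtain i0 where i0: "i0 < n" "v $ i0 \<noteq> 0"
  proof -
    have "\<exists>i<n. v $ i \<noteq> 0"
    proof (rule ccontr)
      assume "\<not> ?thesis"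
      then have "v = 0\<^sub>v n" using v(1) by (intro eq_vecI) auto
      then show False using v(2) by simp
    qed
    then show ?thesis using that by blast
  qed
  define N where "N = (\<Sum>i<n. cnj (v $ i) * v $ i)"
  define R where "R = (\<Sum>i<n. \<Sum>j<n. of_int (S i j) * (cnj (v $ i) * v $ j))"
  have N: "N = of_real (\<Sum>i<n. (cmod (v $ i))^2)"
    unfolding N_def by (simp add: complex_norm_square mult.commute del: of_real_power)
  have Npos: "(\<Sum>i<n. (cmod (v $ i))^2) > 0"
    by (rule sum_pos2[of _ i0]) (use i0 in auto)
  have RN: "R = k * N"
  proof -
    have "R = (\<Sum>i<n. cnj (v $ i) * (\<Sum>j<n. of_int (S i j) * v $ j))"
      unfolding R_def by (simp add: sum_distrib_left mult_ac)
    also have "\<dots> = (\<Sum>i<n. cnj (v $ i) * (k * v $ i))" using eq by (intro sum.cong) auto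
    also have "\<dots> = k * N" unfolding N_def by (simp add: sum_distrib_left mult_ac)
    finally show ?thesis .
  qed
  have "cnj R = R"
  proof -
    have "cnj R = (\<Sum>i<n. \<Sum>j<n. of_int (S i j) * (v $ i * cnj (v $ j)))"
      unfolding R_def by simp
    also have "\<dots> = (\<Sum>j<n. \<Sum>i<n. of_int (S i j) * (v $ i * cnj (v $ j)))" by (rule sum.swap)
    also have "\<dots> = R" unfolding R_def by (intro sum.cong refl) (simp add: mult_ac sym[rule_format])
    finally show ?thesis .
  qed
  moreover have "cnj N = N" unfolding N by simp
  ultimately have "cnj k * N = k * N" unfolding RN by simp
  moreover have "N \<noteq> 0" unfolding N using Npos by (simp only: of_real_eq_0_iff)
  ultimately have "cnj k = k" by simp
  then have k: "k = of_real (Re k)" by (simp add: complex_eq_iff)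
  have re: "(\<Sum>j<n. of_int (S i j) * Re (v $ j)) = Re k * Re (v $ i)" if "i < n" for i
  proof -
    have "Re (\<Sum>j<n. of_int (S i j) * v $ j) = Re (k * v $ i)" using eq[OF that] by simp
    then show ?thesis by (subst (asm) k) simp
  qed
  have im: "(\<Sum>j<n. of_int (S i j) * Im (v $ j)) = Re k * Im (v $ i)" if "i < n" for i
  proof -
    have "Im (\<Sum>j<n. of_int (S i j) * v $ j) = Im (k * v $ i)" using eq[OF that] by simp
    then show ?thesis by (subst (asm) k) simp
  qed
  have "Re (v $ i0) \<noteq> 0 \<or> Im (v $ i0) \<noteq> 0" using i0 by (auto simp: complex_eq_iff)
  then have "eigenpair n S (Re k) (\<lambda>i. Re (v $ i)) \<or> eigenpair n S (Re k) (\<lambda>i. Im (v $ i))"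
    using re im i0 unfolding eigenpair_def by blast
  then show ?thesis using that k by blast
qed

lemma sg_spectral_radius_attained:
  assumes sym: "\<forall>i j. S i j = S j i" and n: "n > 0"
  obtains e x where "eigenpair n S e x" "sg_spectral_radius n S = \<bar>e\<bar>"
proof -
  obtain k where "eigenvalue (adj_mat n S) k" "sg_spectral_radius n S = cmod k"
    using spectral_radius_mem_max(1)[OF adj_mat_carrier n, of S] unfolding sg_spectral_radius_def spectrum_def by auto
  moreover then obtain e x where "k = of_real e" "eigenpair n S e x" using eigenvalue_adj_matE[OF sym] by blast
  ultimately show ?thesis using that by simp
qed

lemma eigenpair_le_sg_spectral_radius:
  assumes "eigenpair n S e x"
  shows "\<bar>e\<bar> \<le> sg_spectral_radius n S"
proof -
  have "n > 0" using assms unfolding eigenpair_def by auto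
  moreover have "cmod (of_real e) \<in> cmod ` spectrum (adj_mat n S)"
    using eigenvalue_adj_matI[OF assms] unfolding spectrum_def by blast
  ultimately show ?thesis using spectral_radius_mem_max(2)[OF adj_mat_carrier]
    unfolding sg_spectral_radius_def by simp
qed

section \<open>Switching and quadratic forms\<close>

definition switch :: "(nat \<Rightarrow> int) \<Rightarrow> (nat \<Rightarrow> nat \<Rightarrow> int) \<Rightarrow> nat \<Rightarrow> nat \<Rightarrow> int" where
  "switch \<theta> S i j = \<theta> i * S i j * \<theta> j"

definition signs :: "(nat \<Rightarrow> int) \<Rightarrow> bool" where
  "signs \<theta> \<longleftrightarrow> (\<forall>i. \<theta> i \<in> {-1, 1})"

text \<open>For degenerate closed walks the products below are 0 or squares, so no distinctness is required.\<close>
definition no_short_neg :: "nat \<Rightarrow> (nat \<Rightarrow> nat \<Rightarrow> int) \<Rightarrow> bool" where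
  "no_short_neg n S \<longleftrightarrow> signed_graph n S \<and>
     (\<forall>u v w. S u v * S v w * S w u \<noteq> -1) \<and> (\<forall>u v w t. S u v * S v w * S w t * S t u \<noteq> -1)"

lemma signed_graphD:
  assumes "signed_graph n S"
  shows "S u v = -1 \<or> S u v = 0 \<or> S u v = 1" "S u v = S v u" "S u u = 0" "S u v \<noteq> 0 \<Longrightarrow> u < n" "S u v \<noteq> 0 \<Longrightarrow> v < n"
  using assms unfolding signed_graph_def by blast+

lemma no_short_negD:
  assumes "no_short_neg n S"
  shows "signed_graph n S" "S u v * S v w * S w u \<noteq> -1" "S u v * S v w * S w t * S t u \<noteq> -1"
  using assms unfolding no_short_neg_def by blast+

lemma signsD: "signs \<theta> \<Longrightarrow> \<theta> i = -1 \<or> \<theta> i = 1" "signs \<theta> \<Longrightarrow> \<theta> i * \<theta> i = 1"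
proof -
  show *: "signs \<theta> \<Longrightarrow> \<theta> i = -1 \<or> \<theta> i = 1" unfolding signs_def by blast
  show "signs \<theta> \<Longrightarrow> \<theta> i * \<theta> i = 1" using * by auto
qed

lemma no_short_negI:
  assumes S: "signed_graph n S" and neg: "\<forall>cs. negative_cycle n S cs \<longrightarrow> length cs \<noteq> 3 \<and> length cs \<noteq> 4"
  shows "no_short_neg n S"
proof -
  note d = signed_graphD[OF S]
  have 3: "S u v * S v w * S w u \<noteq> -1" for u v w
  proof
    assume p: "S u v * S v w * S w u = -1"
    then have nz: "S u v \<noteq> 0" "S v w \<noteq> 0" "S w u \<noteq> 0" by auto
    then have ne: "u \<noteq> v" "v \<noteq> w" "w \<noteq> u" using d(3) by auto
    have lt: "u < n" "v < n" "w < n" using nz d(4) by blast+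
    have "S ([u,v,w] ! i) ([u,v,w] ! ((i + 1) mod 3)) \<noteq> 0" if "i < 3" for i
    proof -
      have "i = 0 \<or> i = 1 \<or> i = 2" using that by linarith
      then show ?thesis using nz by (elim disjE) simp_all
    qed
    then have "is_cycle n S [u,v,w]" unfolding is_cycle_def
      using ne lt by simp
    moreover have "{..<3} = {0,1,2::nat}" by auto
    then have "cycle_sign S [u,v,w] = -1" unfolding cycle_sign_def
      using p by (simp add: mult.assoc)
    ultimately show False using neg unfolding negative_cycle_def by force
  qed
  have 4: "S u v * S v w * S w t * S t u \<noteq> -1" for u v w t
  proof
    assume p: "S u v * S v w * S w t * S t u = -1"
    then have nz: "S u v \<noteq> 0" "S v w \<noteq> 0" "S w t \<noteq> 0" "S t u \<noteq> 0" by auto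
    then have ne: "u \<noteq> v" "v \<noteq> w" "w \<noteq> t" "t \<noteq> u" using d(3) by auto
    have uw: "u \<noteq> w"
    proof
      assume "u = w"
      then have "S u v * S v w * S w t * S t u = (S u v * S u t)^2" using d(2) by (simp add: power2_eq_square)
      moreover have "\<dots> \<ge> 0" by simp
      ultimately show False using p by linarith
    qed
    have vt: "v \<noteq> t"
    proof
      assume "v = t"
      then have "S u v * S v w * S w t * S t u = (S u v * S v w)^2" using d(2) by (simp add: power2_eq_square)
      moreover have "\<dots> \<ge> 0" by simp
      ultimately show False using p by linarith
    qed
    have lt: "u < n" "v < n" "w < n" "t < n" using nz d(4) by blast+
    have "S ([u,v,w,t] ! i) ([u,v,w,t] ! ((i + 1) mod 4)) \<noteq> 0" if "i < 4" for i
    proof -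
      have "i = 0 \<or> i = 1 \<or> i = 2 \<or> i = 3" using that by linarith
      then show ?thesis using nz by (elim disjE) simp_all
    qed
    then have "is_cycle n S [u,v,w,t]" unfolding is_cycle_def
      using ne uw vt lt by simp
    moreover have "{..<4} = {0,1,2,3::nat}" by auto
    then have "cycle_sign S [u,v,w,t] = -1" unfolding cycle_sign_def
      using p by (simp add: mult.assoc)
    moreover have "length [u,v,w,t] = 4" by simp
    ultimately show False using neg unfolding negative_cycle_def by blast
  qed
  show ?thesis unfolding no_short_neg_def using S 3 4 by blast
qed

lemma signed_graph_switch:
  assumes S: "signed_graph n S" and t: "signs \<theta>"
  shows "signed_graph n (switch \<theta> S)"
proof -
  note d = signed_graphD[OF S]
  have "switch \<theta> S u v \<in> {-1, 0, 1}" for u v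
    using d(1)[of u v] signsD(1)[OF t, of u] signsD(1)[OF t, of v] unfolding switch_def by auto
  moreover have "switch \<theta> S u v = switch \<theta> S v u" for u v
    unfolding switch_def using d(2)[of u v] by simp
  ultimately show ?thesis using S unfolding signed_graph_def by (auto simp: switch_def)
qed

lemma no_short_neg_switch:
  assumes S: "no_short_neg n S" and t: "signs \<theta>"
  shows "no_short_neg n (switch \<theta> S)"
proof -
  note d = signsD(2)[OF t]
  have 3: "switch \<theta> S u v * switch \<theta> S v w * switch \<theta> S w u = S u v * S v w * S w u" for u v w
  proof -
    have "switch \<theta> S u v * switch \<theta> S v w * switch \<theta> S w u
       = S u v * S v w * S w u * (\<theta> u * \<theta> u) * (\<theta> v * \<theta> v) * (\<theta> w * \<theta> w)"
      unfolding switch_def by simp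
    then show ?thesis unfolding d by simp
  qed
  have 4: "switch \<theta> S u v * switch \<theta> S v w * switch \<theta> S w t * switch \<theta> S t u = S u v * S v w * S w t * S t u" for u v w t
  proof -
    have "switch \<theta> S u v * switch \<theta> S v w * switch \<theta> S w t * switch \<theta> S t u
       = S u v * S v w * S w t * S t u * (\<theta> u * \<theta> u) * (\<theta> v * \<theta> v) * (\<theta> w * \<theta> w) * (\<theta> t * \<theta> t)"
      unfolding switch_def by simp
    then show ?thesis unfolding d by simp
  qed
  show ?thesis using S signed_graph_switch[OF _ t] unfolding no_short_neg_def 3 4 by blast
qed

lemma prod_cyclic_shift:
  fixes f :: "nat \<Rightarrow> 'a :: comm_monoid_mult"
  shows "(\<Prod>i<L. f ((i + 1) mod L)) = (\<Prod>i<L. f i)"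
proof (cases L)
  case (Suc m)
  have "(\<Prod>i<Suc m. f ((i + 1) mod Suc m)) = (\<Prod>i<m. f (Suc i)) * f 0"
    by (simp add: mod_less)
  also have "\<dots> = (\<Prod>i<Suc m. f i)" by (subst prod.lessThan_Suc_shift) (simp add: mult.commute)
  finally show ?thesis unfolding Suc .
qed simp

text \<open>Each edge of \<open>S\<close> then has sign \<open>\<theta> i * \<theta> j\<close>, so
  every vertex sign enters the product around a cycle twice.\<close>

lemma balanced_if_switched_nonneg:
  assumes S: "signed_graph n S" and t: "signs \<theta>" and pos: "\<And>i j. switch \<theta> S i j \<noteq> -1"
  shows "balanced n S"
  unfolding balanced_def
proof (intro allI impI)
  fix cs assume c: "is_cycle n S cs"
  have e: "S i j = \<theta> i * \<theta> j" if "S i j \<noteq> 0" for i j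
    using that pos[of i j] signed_graphD(1)[OF S, of i j] signsD(1)[OF t, of i] signsD(1)[OF t, of j]
    unfolding switch_def by auto
  have "cycle_sign S cs = (\<Prod>i<length cs. \<theta> (cs ! i) * \<theta> (cs ! ((i + 1) mod length cs)))"
    unfolding cycle_sign_def using c unfolding is_cycle_def by (intro prod.cong refl e) auto
  also have "\<dots> = (\<Prod>i<length cs. \<theta> (cs ! i)) * (\<Prod>i<length cs. \<theta> (cs ! i))"
    unfolding prod.distrib prod_cyclic_shift[of "\<lambda>i. \<theta> (cs ! i)"] ..
  also have "\<dots> = (\<Prod>i<length cs. \<theta> (cs ! i) * \<theta> (cs ! i))" by (simp add: prod.distrib)
  also have "\<dots> = 1" using signsD(2)[OF t] by simp
  finally show "cycle_sign S cs = 1" .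
qed

definition qf :: "nat \<Rightarrow> (nat \<Rightarrow> nat \<Rightarrow> int) \<Rightarrow> (nat \<Rightarrow> real) \<Rightarrow> real" where
  "qf n T x = (\<Sum>i<n. \<Sum>j<n. of_int (T i j) * x i * x j)"

lemma qf_mono:
  assumes "\<And>i j. i < n \<Longrightarrow> j < n \<Longrightarrow> T i j \<le> T' i j" "\<And>i. x i \<ge> 0"
  shows "qf n T x \<le> qf n T' x"
  unfolding qf_def by (intro sum_mono mult_right_mono) (use assms in auto)

text \<open>The difference of the two forms is a sum of nonnegative entries with positive weights
  \<open>x i * x j\<close>. This turns an equality of numbers into an equality of graphs.\<close>

lemma qf_eq_imp_eq:
  assumes le: "\<And>i j. i < n \<Longrightarrow> j < n \<Longrightarrow> T i j \<le> T' i j" and x: "\<And>i. i < n \<Longrightarrow> x i > 0"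
    and eq: "qf n T x = qf n T' x" and ij: "i < n" "j < n"
  shows "T i j = T' i j"
proof -
  have "(\<Sum>i<n. \<Sum>j<n. of_int (T' i j - T i j) * x i * x j) = 0"
    using eq unfolding qf_def by (simp add: left_diff_distrib sum_subtractf)
  moreover have nn: "of_int (T' i j - T i j) * x i * x j \<ge> 0" if "i < n" "j < n" for i j
    using le[OF that] x that by (intro mult_nonneg_nonneg) (auto simp: less_imp_le)
  ultimately have "(\<Sum>j<n. of_int (T' i j - T i j) * x i * x j) = 0"
    using ij by (subst (asm) sum_nonneg_eq_0_iff) (auto intro!: sum_nonneg)
  then have "of_int (T' i j - T i j) * x i * x j = 0"
    using nn ij by (subst (asm) sum_nonneg_eq_0_iff) auto
  then show ?thesis using x[OF ij(1)] x[OF ij(2)] by simp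
qed

definition flip_maximal :: "(nat \<Rightarrow> nat \<Rightarrow> int) \<Rightarrow> bool" where
  "flip_maximal T \<longleftrightarrow> (\<forall>K i j. i \<in> K \<longrightarrow> j \<notin> K \<longrightarrow> T i j = -1 \<longrightarrow> (\<exists>i'\<in>K. \<exists>j'. j' \<notin> K \<and> T i' j' = 1))"

text \<open>Take a switching with the largest sum of entries among those not decreasing the form: if only negative
  edges crossed K, flipping K would increase that sum.\<close>
lemma maximal_switching:
  assumes S: "signed_graph n S" and x: "\<And>i. x i \<ge> 0"
  shows "\<exists>\<theta>. signs \<theta> \<and> qf n S x \<le> qf n (switch \<theta> S) x \<and> flip_maximal (switch \<theta> S)"
proof -
  define P where "P \<theta> \<longleftrightarrow> signs \<theta> \<and> qf n S x \<le> qf n (switch \<theta> S) x" for \<theta>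
  define s where "s \<theta> = (\<Sum>i<n. \<Sum>j<n. switch \<theta> S i j)" for \<theta>
  \<comment> \<open>The shift by n^2 makes the sum of entries nonnegative, so \<open>nat\<close>
    preserves its order and the measure is a bounded natural number.\<close>
  define f where "f \<theta> = nat (int (n * n) + s \<theta>)" for \<theta>
  have bd: "\<bar>s \<theta>\<bar> \<le> int (n * n)" if "signs \<theta>" for \<theta>
  proof -
    have "\<bar>s \<theta>\<bar> \<le> (\<Sum>i<n. \<Sum>j<n. \<bar>switch \<theta> S i j\<bar>)"
      unfolding s_def by (rule order_trans[OF sum_abs sum_mono[OF sum_abs]])
    also have "\<dots> \<le> (\<Sum>i<n. \<Sum>j<n. 1)"
    proof (intro sum_mono)
      fix i j
      show "\<bar>switch \<theta> S i j\<bar> \<le> 1"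
        using signed_graphD(1)[OF signed_graph_switch[OF S that], of i j] by linarith
    qed
    finally show ?thesis by simp
  qed
  have "P (\<lambda>_. 1)" unfolding P_def signs_def switch_def by simp
  moreover have "\<forall>\<theta>. P \<theta> \<longrightarrow> f \<theta> < Suc (2 * (n * n))"
  proof (intro allI impI)
    fix \<theta> assume "P \<theta>"
    then have "\<bar>s \<theta>\<bar> \<le> int (n * n)" using bd unfolding P_def by blast
    then have "int (n * n) + s \<theta> \<le> int (2 * (n * n))" by simp
    then show "f \<theta> < Suc (2 * (n * n))" unfolding f_def less_Suc_eq_le nat_le_iff .
  qed
  ultimately have "\<exists>\<theta>. P \<theta> \<and> (\<forall>\<theta>'. P \<theta>' \<longrightarrow> f \<theta>' \<le> f \<theta>)"
    by (rule ex_has_greatest_nat)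
  then obtain \<theta> where \<theta>: "P \<theta>" and mx: "\<forall>\<theta>'. P \<theta>' \<longrightarrow> f \<theta>' \<le> f \<theta>"
    by (elim exE conjE)
  have sg: "signs \<theta>" using \<theta> unfolding P_def by simp
  let ?T = "switch \<theta> S"
  note T = signed_graph_switch[OF S sg]
  have cut: "\<exists>i'\<in>K. \<exists>j'. j' \<notin> K \<and> ?T i' j' = 1" if K: "i \<in> K" "j \<notin> K" "?T i j = -1" for K i j
  proof (rule ccontr)
    assume no: "\<not> ?thesis"
    define \<theta>' where "\<theta>' i = (if i \<in> K then - \<theta> i else \<theta> i)" for i
    have sg': "signs \<theta>'" using sg unfolding signs_def \<theta>'_def by auto
    have T': "switch \<theta>' S u v = (if (u \<in> K) = (v \<in> K) then ?T u v else - ?T u v)" for u v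
      unfolding switch_def \<theta>'_def by simp
    have np: "?T u v \<le> 0" if "(u \<in> K) \<noteq> (v \<in> K)" for u v
    proof -
      have "?T u v \<noteq> 1"
      proof (cases "u \<in> K")
        case True
        then show ?thesis using no that by blast
      next
        case False
        then have "?T v u \<noteq> 1" using no that by blast
        then show ?thesis by (subst signed_graphD(2)[OF T])
      qed
      then show ?thesis using signed_graphD(1)[OF T, of u v] by linarith
    qed
    have le: "?T u v \<le> switch \<theta>' S u v" for u v
    proof (cases "(u \<in> K) = (v \<in> K)")
      case False
      then show ?thesis using np[OF False] T'[of u v] by simp
    qed (simp add: T')
    have "qf n ?T x \<le> qf n (switch \<theta>' S) x" by (intro qf_mono le x)
    then have P': "P \<theta>'" using \<theta> sg' unfolding P_def by simp
    have ij: "i < n" "j < n" using K(3) signed_graphD(4,5)[OF T, of i j] by auto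
    have "?T i j < switch \<theta>' S i j" using K unfolding T' by simp
    then have "(\<Sum>v<n. ?T i v) < (\<Sum>v<n. switch \<theta>' S i v)"
      using ij(2) le by (intro sum_strict_mono_ex1) auto
    then have "s \<theta> < s \<theta>'" unfolding s_def
      using ij(1) le by (intro sum_strict_mono_ex1) (auto intro!: sum_mono)
    moreover have "0 \<le> int (n * n) + s \<theta>" using bd[OF sg] by linarith
    ultimately have "f \<theta> < f \<theta>'" unfolding f_def by (subst nat_less_eq_zless) linarith+
    then show False using mx[rule_format, OF P'] by simp
  qed
  have "qf n S x \<le> qf n ?T x" using \<theta> unfolding P_def by (rule conjunct2)
  then show ?thesis using sg cut unfolding flip_maximal_def by (intro exI[of _ \<theta>] conjI allI impI)
qed

section \<open>The extremal graphs\<close>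

text \<open>The densest candidate: cliques on A union C and B union C, v1 joined to A, v2 joined to B, and the
  negative edge v1 v2, where C consists of all other vertices. It is written as a low-rank expression
  in the indicators of these sets so that its quadratic form can be read off.\<close>
definition ext_graph :: "nat set \<Rightarrow> nat set \<Rightarrow> nat \<Rightarrow> nat \<Rightarrow> nat \<Rightarrow> nat \<Rightarrow> int" where
  "ext_graph A B v1 v2 i j =
     (let W = (\<lambda>i. of_bool (i \<noteq> v1 \<and> i \<noteq> v2));
          f = (\<lambda>i. of_bool (i \<in> A) - of_bool (i = v2));
          g = (\<lambda>i. of_bool (i \<in> B) - of_bool (i = v1))
      in W i * W j - of_bool (i = j) * W i - f i * g j - g i * f j)"

definition five_parts :: "nat \<Rightarrow> nat set \<Rightarrow> nat set \<Rightarrow> nat set \<Rightarrow> nat \<Rightarrow> nat \<Rightarrow> bool" where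
  "five_parts n A B C v1 v2 \<longleftrightarrow> {..<n} = insert v1 (insert v2 (A \<union> (B \<union> C))) \<and> A \<inter> B = {} \<and> A \<inter> C = {} \<and> B \<inter> C = {} \<and>
     v1 \<noteq> v2 \<and> v1 \<notin> A \<union> (B \<union> C) \<and> v2 \<notin> A \<union> (B \<union> C)"

lemma five_parts_finite:
  assumes "five_parts n A B C v1 v2"
  shows "finite A" "finite B" "finite C" "finite (A \<union> (B \<union> C))"
proof -
  have "{..<n} = insert v1 (insert v2 (A \<union> (B \<union> C)))" using assms unfolding five_parts_def by (rule conjunct1)
  then have "finite (insert v1 (insert v2 (A \<union> (B \<union> C))))" by (metis finite_lessThan)
  then show "finite (A \<union> (B \<union> C))" by simp
  then show "finite A" "finite B" "finite C" by simp_all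
qed

lemma five_partsD:
  assumes "five_parts n A B C v1 v2"
  shows "v1 \<noteq> v2" "v1 \<notin> A" "v1 \<notin> B" "v2 \<notin> A" "v2 \<notin> B"
    "i \<in> A \<Longrightarrow> i \<noteq> v1 \<and> i \<noteq> v2 \<and> i \<notin> B"
    "i \<in> B \<Longrightarrow> i \<noteq> v1 \<and> i \<noteq> v2 \<and> i \<notin> A"
    "i \<in> C \<Longrightarrow> i \<noteq> v1 \<and> i \<noteq> v2 \<and> i \<notin> A \<and> i \<notin> B"
proof -
  have "A \<inter> B = {}" "A \<inter> C = {}" "B \<inter> C = {}" "v1 \<noteq> v2" "v1 \<notin> A \<union> (B \<union> C)" "v2 \<notin> A \<union> (B \<union> C)"
    using assms unfolding five_parts_def by simp_all
  then show "v1 \<noteq> v2" "v1 \<notin> A" "v1 \<notin> B" "v2 \<notin> A" "v2 \<notin> B"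
    "i \<in> A \<Longrightarrow> i \<noteq> v1 \<and> i \<noteq> v2 \<and> i \<notin> B"
    "i \<in> B \<Longrightarrow> i \<noteq> v1 \<and> i \<noteq> v2 \<and> i \<notin> A"
    "i \<in> C \<Longrightarrow> i \<noteq> v1 \<and> i \<noteq> v2 \<and> i \<notin> A \<and> i \<notin> B"
    by auto
qed

lemma sum_five_parts:
  fixes h :: "nat \<Rightarrow> 'a :: comm_monoid_add"
  assumes p: "five_parts n A B C v1 v2"
  shows "sum h {..<n} = h v1 + (h v2 + (sum h A + (sum h B + sum h C)))"
proof -
  note fin = five_parts_finite[OF p]
  have "sum h {..<n} = sum h (insert v1 (insert v2 (A \<union> (B \<union> C))))"
    using p unfolding five_parts_def by metis
  also have "\<dots> = h v1 + (h v2 + sum h (A \<union> (B \<union> C)))"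
    using p fin unfolding five_parts_def by simp
  also have "sum h (A \<union> (B \<union> C)) = sum h A + (sum h B + sum h C)"
  proof -
    have "A \<inter> (B \<union> C) = {}" "B \<inter> C = {}" using p unfolding five_parts_def by (simp_all add: Int_Un_distrib)
    then show ?thesis using fin by (simp add: sum.union_disjoint)
  qed
  finally show ?thesis .
qed

lemma sum_five_parts_weighted:
  fixes h :: "nat \<Rightarrow> real"
  assumes p: "five_parts n A B C v1 v2"
  shows "(\<Sum>i<n. of_bool (i \<noteq> v1 \<and> i \<noteq> v2) * h i) = sum h A + sum h B + sum h C"
    and "(\<Sum>i<n. (of_bool (i \<in> A) - of_bool (i = v2)) * h i) = sum h A - h v2"
    and "(\<Sum>i<n. (of_bool (i \<in> B) - of_bool (i = v1)) * h i) = sum h B - h v1"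
proof -
  note d = five_partsD[OF p]
  define W :: "nat \<Rightarrow> real" where "W i = of_bool (i \<noteq> v1 \<and> i \<noteq> v2)" for i
  define f :: "nat \<Rightarrow> real" where "f i = of_bool (i \<in> A) - of_bool (i = v2)" for i
  define g :: "nat \<Rightarrow> real" where "g i = of_bool (i \<in> B) - of_bool (i = v1)" for i
  have "W v1 = 0" "W v2 = 0" unfolding W_def by simp_all
  moreover have "i \<in> A \<Longrightarrow> W i = 1" "i \<in> B \<Longrightarrow> W i = 1" "i \<in> C \<Longrightarrow> W i = 1" for i
    using d(6-8)[of i] unfolding W_def by simp_all
  ultimately have "(\<Sum>i<n. W i * h i) = sum h A + sum h B + sum h C" unfolding sum_five_parts[OF p] by simp
  moreover have "(\<Sum>i<n. f i * h i) = sum h A - h v2"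
  proof -
    have "f v1 = 0" "f v2 = -1" using d(1-5) unfolding f_def by simp_all
    moreover have "i \<in> A \<Longrightarrow> f i = 1" "i \<in> B \<Longrightarrow> f i = 0" "i \<in> C \<Longrightarrow> f i = 0" for i
      using d(6-8)[of i] unfolding f_def by simp_all
    ultimately show ?thesis unfolding sum_five_parts[OF p] by simp
  qed
  moreover have "(\<Sum>i<n. g i * h i) = sum h B - h v1"
  proof -
    have "g v1 = -1" "g v2 = 0" using d(1-5) unfolding g_def by simp_all
    moreover have "i \<in> A \<Longrightarrow> g i = 0" "i \<in> B \<Longrightarrow> g i = 1" "i \<in> C \<Longrightarrow> g i = 0" for i
      using d(6-8)[of i] unfolding g_def by simp_all
    ultimately show ?thesis unfolding sum_five_parts[OF p] by simp
  qed
  ultimately show "(\<Sum>i<n. of_bool (i \<noteq> v1 \<and> i \<noteq> v2) * h i) = sum h A + sum h B + sum h C"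
    "(\<Sum>i<n. (of_bool (i \<in> A) - of_bool (i = v2)) * h i) = sum h A - h v2"
    "(\<Sum>i<n. (of_bool (i \<in> B) - of_bool (i = v1)) * h i) = sum h B - h v1"
    unfolding W_def f_def g_def .
qed

lemma ext_graph_row_sum:
  fixes x :: "nat \<Rightarrow> real"
  assumes p: "five_parts n A B C v1 v2" and i: "i < n"
  shows "(\<Sum>j<n. of_int (ext_graph A B v1 v2 i j) * x j) =
    of_bool (i \<noteq> v1 \<and> i \<noteq> v2) * (sum x A + sum x B + sum x C - x i)
    - (of_bool (i \<in> A) - of_bool (i = v2)) * (sum x B - x v1)
    - (of_bool (i \<in> B) - of_bool (i = v1)) * (sum x A - x v2)"
proof -
  define W :: "nat \<Rightarrow> real" where "W i = of_bool (i \<noteq> v1 \<and> i \<noteq> v2)" for i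
  define f :: "nat \<Rightarrow> real" where "f i = of_bool (i \<in> A) - of_bool (i = v2)" for i
  define g :: "nat \<Rightarrow> real" where "g i = of_bool (i \<in> B) - of_bool (i = v1)" for i
  note sums = sum_five_parts_weighted[OF p, of x, folded W_def f_def g_def]
  have "of_int (ext_graph A B v1 v2 i j) = W i * W j - (if i = j then W i else 0) - f i * g j - g i * f j" for j
    by (cases "i = j") (simp_all only: ext_graph_def Let_def W_def f_def g_def, simp_all)
  then have "of_int (ext_graph A B v1 v2 i j) * x j =
     W i * (W j * x j) - (if i = j then W i * x j else 0) - f i * (g j * x j) - g i * (f j * x j)" for j
    by (simp add: left_diff_distrib)
  then have "(\<Sum>j<n. of_int (ext_graph A B v1 v2 i j) * x j) =
     W i * (\<Sum>j<n. W j * x j) - (\<Sum>j<n. if i = j then W i * x j else 0) - f i * (\<Sum>j<n. g j * x j) - g i * (\<Sum>j<n. f j * x j)"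
    by (simp add: sum_subtractf sum_distrib_left)
  also have "(\<Sum>j<n. if i = j then W i * x j else 0) = W i * x i" using i by simp
  finally show ?thesis unfolding sums unfolding W_def f_def g_def by (simp add: right_diff_distrib)
qed

lemma qf_ext_graph:
  assumes p: "five_parts n A B C v1 v2"
  shows "qf n (ext_graph A B v1 v2) x = (sum x A + sum x B + sum x C)^2
     - ((\<Sum>i\<in>A. (x i)^2) + (\<Sum>i\<in>B. (x i)^2) + (\<Sum>i\<in>C. (x i)^2))
     - 2 * (sum x A - x v2) * (sum x B - x v1)"
proof -
  define W :: "nat \<Rightarrow> real" where "W i = of_bool (i \<noteq> v1 \<and> i \<noteq> v2)" for i
  define f :: "nat \<Rightarrow> real" where "f i = of_bool (i \<in> A) - of_bool (i = v2)" for i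
  define g :: "nat \<Rightarrow> real" where "g i = of_bool (i \<in> B) - of_bool (i = v1)" for i
  note sums = sum_five_parts_weighted[OF p, folded W_def f_def g_def]
  define s where "s = sum x A + sum x B + sum x C"
  have "qf n (ext_graph A B v1 v2) x = (\<Sum>i<n. x i * (\<Sum>j<n. of_int (ext_graph A B v1 v2 i j) * x j))"
    unfolding qf_def by (simp add: sum_distrib_left mult_ac)
  also have "\<dots> = (\<Sum>i<n. s * (W i * x i) - W i * (x i)^2 - (sum x B - x v1) * (f i * x i) - (sum x A - x v2) * (g i * x i))"
  proof (intro sum.cong refl)
    fix i assume "i \<in> {..<n}"
    then have i: "i < n" by simp
    show "x i * (\<Sum>j<n. of_int (ext_graph A B v1 v2 i j) * x j) =
      s * (W i * x i) - W i * (x i)^2 - (sum x B - x v1) * (f i * x i) - (sum x A - x v2) * (g i * x i)"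
      unfolding ext_graph_row_sum[OF p i] W_def[symmetric] f_def[symmetric] g_def[symmetric] s_def[symmetric]
      by (simp add: algebra_simps power2_eq_square)
  qed
  also have "\<dots> = s * (\<Sum>i<n. W i * x i) - (\<Sum>i<n. W i * (x i)^2)
      - (sum x B - x v1) * (\<Sum>i<n. f i * x i) - (sum x A - x v2) * (\<Sum>i<n. g i * x i)"
    by (simp only: sum_subtractf sum_distrib_left)
  also have "\<dots> = s * s - ((\<Sum>i\<in>A. (x i)^2) + (\<Sum>i\<in>B. (x i)^2) + (\<Sum>i\<in>C. (x i)^2))
      - (sum x B - x v1) * (sum x A - x v2) - (sum x A - x v2) * (sum x B - x v1)"
    unfolding sums s_def ..
  finally show ?thesis unfolding s_def power2_eq_square by simp
qed

text \<open>The variance on a part: it separates the part sums, which enter the five-variable form,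
  from the deviations, which must vanish at equality and so make the vector constant on each
  part.\<close>

lemma sum_squares_deviation:
  fixes x :: "'a \<Rightarrow> real"
  assumes "finite A" "A \<noteq> {}"
  shows "(\<Sum>i\<in>A. (x i)^2) - (sum x A)^2 / card A = (\<Sum>i\<in>A. (x i - sum x A / card A)^2)"
proof -
  have c: "real (card A) \<noteq> 0" using assms by simp
  have dev: "(\<Sum>i\<in>A. (x i - m)^2) = (\<Sum>i\<in>A. (x i)^2) - 2 * m * sum x A + card A * m^2" for m :: real
    by (simp add: power2_diff sum.distrib sum_subtractf sum_distrib_left sum_distrib_right mult_ac)
  have "real (card A) * (sum x A / card A)^2 = (sum x A)^2 / card A" using c by (simp add: power2_eq_square)
  moreover have "2 * (sum x A / card A) * sum x A = 2 * ((sum x A)^2 / card A)" by (simp add: power2_eq_square)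
  ultimately show ?thesis unfolding dev by linarith
qed

lemma qf_ext_graph_le:
  assumes n: "n \<ge> 6" and p: "five_parts n A B C v1 v2" and ne: "A \<noteq> {}" "B \<noteq> {}" "C \<noteq> {}"
  shows "qf n (ext_graph A B v1 v2) x \<le> gamma_n n * (\<Sum>i<n. (x i)^2)"
    and "qf n (ext_graph A B v1 v2) x = gamma_n n * (\<Sum>i<n. (x i)^2) \<Longrightarrow> (\<And>i. x i \<ge> 0) \<Longrightarrow>
      k < n \<Longrightarrow> x k \<noteq> 0 \<Longrightarrow> card A = 1 \<and> card B = 1 \<and> (\<forall>i<n. x i > 0)"
proof -
  define l where "l = gamma_n n"
  note fin = five_parts_finite[OF p]
  have l: "l \<ge> 2" unfolding l_def by (rule gamma_n_ge_2[OF n])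
  have card1: "real (card A) \<ge> 1" "real (card B) \<ge> 1" "real (card C) \<ge> 1"
    using fin ne by (simp_all add: Suc_le_eq card_gt_0_iff)
  have "real n - 2 = card A + card B + card C"
    using sum_five_parts[OF p, of "\<lambda>_. 1::real"] by simp
  then have cards: "real (card A) + card B + card C = l + 1 + 2 * l / (l^2 + 3 * l + 1)"
    using order_eq_gamma_n[OF n] unfolding l_def by linarith
  define dev where "dev D = (\<Sum>i\<in>D. (x i - sum x D / card D)^2)" for D
  have dev0: "dev D \<ge> 0" for D unfolding dev_def by (intro sum_nonneg) simp
  have dev: "(\<Sum>i\<in>D. (x i)^2) = dev D + (sum x D)^2 / card D" if "finite D" "D \<noteq> {}" for D
    using sum_squares_deviation[OF that, of x] unfolding dev_def by simp
  define F where "F = (l + 1) * ((sum x A)^2 / card A + (sum x B)^2 / card B + (sum x C)^2 / card C)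
     + l * ((x v1)^2 + (x v2)^2) - (sum x A + sum x B + sum x C)^2 + 2 * (sum x A - x v2) * (sum x B - x v1)"
  note form = reduced_form_nonneg[OF l card1 cards, of "sum x A" "sum x B" "sum x C" "x v1" "x v2", folded F_def]
  \<comment> \<open>Deviations carry the weight \<open>l + 1\<close>: \<open>l\<close> from the
    squared norm, and 1 from the zero diagonal on the parts.\<close>
  have id: "l * (\<Sum>i<n. (x i)^2) - qf n (ext_graph A B v1 v2) x = F + (l + 1) * (dev A + dev B + dev C)"
    unfolding F_def qf_ext_graph[OF p] sum_five_parts[OF p] dev[OF fin(1) ne(1)] dev[OF fin(2) ne(2)] dev[OF fin(3) ne(3)]
    by (simp add: algebra_simps add_divide_distrib)
  have dd: "(l + 1) * (dev A + dev B + dev C) \<ge> 0" using l dev0[of A] dev0[of B] dev0[of C] by simp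
  show "qf n (ext_graph A B v1 v2) x \<le> gamma_n n * (\<Sum>i<n. (x i)^2)"
    using id dd form(1) unfolding l_def[symmetric] by linarith
  show "card A = 1 \<and> card B = 1 \<and> (\<forall>i<n. x i > 0)"
    if eq: "qf n (ext_graph A B v1 v2) x = gamma_n n * (\<Sum>i<n. (x i)^2)"
      and x0: "\<And>i. x i \<ge> 0" and k: "k < n" "x k \<noteq> 0"
  proof -
    have F0: "F = 0" and "(l + 1) * (dev A + dev B + dev C) = 0"
      using id eq dd form(1) unfolding l_def[symmetric] by linarith+
    then have "dev A + dev B + dev C = 0" using l by simp
    then have d0: "dev A = 0" "dev B = 0" "dev C = 0" using dev0[of A] dev0[of B] dev0[of C] by linarith+
    have const: "x i = sum x D / card D" if "dev D = 0" "finite D" "i \<in> D" for D i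
    proof -
      have "(x i - sum x D / card D)^2 = 0"
        by (rule sum_nonneg_0[OF that(2) _ that(1)[unfolded dev_def] that(3)]) simp
      then show ?thesis by simp
    qed
    have xi: "i = v1 \<or> i = v2 \<or> i \<in> A \<or> i \<in> B \<or> i \<in> C" if "i < n" for i
    proof -
      have "{..<n} = insert v1 (insert v2 (A \<union> (B \<union> C)))" using p unfolding five_parts_def by (rule conjunct1)
      with that have "i \<in> insert v1 (insert v2 (A \<union> (B \<union> C)))" by (metis lessThan_iff)
      then show ?thesis by simp
    qed
    have "sum x A \<noteq> 0 \<or> sum x B \<noteq> 0 \<or> sum x C \<noteq> 0 \<or> x v1 \<noteq> 0 \<or> x v2 \<noteq> 0"
    proof (rule ccontr)
      assume "\<not> ?thesis"
      then have z: "sum x A = 0" "sum x B = 0" "sum x C = 0" "x v1 = 0" "x v2 = 0" by simp_all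
      from xi[OF k(1)] have "x k = 0"
        using const[OF d0(1) fin(1)] const[OF d0(2) fin(2)] const[OF d0(3) fin(3)] z by (elim disjE) simp_all
      then show False using k(2) by simp
    qed
    from form(2)[OF F0 _ _ _ _ _ this] x0
    have pos: "real (card A) = 1 \<and> real (card B) = 1 \<and> sum x A > 0 \<and> sum x B > 0 \<and> sum x C > 0 \<and> x v1 > 0 \<and> x v2 > 0"
      by (simp add: sum_nonneg)
    moreover have "x i > 0" if i: "i < n" for i
    proof -
      have "sum x D / card D > 0" if "sum x D > 0" "real (card D) \<ge> 1" for D using that by simp
      then have "sum x A / card A > 0" "sum x B / card B > 0" "sum x C / card C > 0" using pos card1 by simp_all
      with xi[OF i] pos show ?thesis
        using const[OF d0(1) fin(1), of i] const[OF d0(2) fin(2), of i] const[OF d0(3) fin(3), of i] by (elim disjE) simp_all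
    qed
    ultimately show ?thesis by simp
  qed
qed

text \<open>The cut property is applied to {v1}, {v2}, {v1} with \<open>A\<close>, and {v2} with
  \<open>B\<close>, each of which the negative edge v1 v2 leaves. A common positive neighbour of v1
  and v2 would close a negative triangle, a positive edge between \<open>A\<close> and
  \<open>B\<close> a negative quadrangle; so positive edges leaving the two larger sets end in
  \<open>C\<close>.\<close>

lemma ext_graph_structure:
  assumes T: "no_short_neg n T" and neg: "T v1 v2 = -1"
    and max: "flip_maximal T"
  defines "A \<equiv> {w. T v1 w = 1}" and "B \<equiv> {w. T v2 w = 1}"
  defines "C \<equiv> {..<n} - insert v1 (insert v2 (A \<union> B))"
  shows "five_parts n A B C v1 v2" "A \<noteq> {}" "B \<noteq> {}"
    and "\<exists>a\<in>A. \<exists>c\<in>C. T a c = 1" "\<exists>b\<in>B. \<exists>c\<in>C. T b c = 1"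
    and "T i j \<le> ext_graph A B v1 v2 i j"
proof -
  note cut = max[unfolded flip_maximal_def, rule_format]
  note sg = no_short_negD(1)[OF T]
  note d = signed_graphD[OF sg]
  have neg': "T v2 v1 = -1" using neg d(2)[of v1 v2] by simp
  have v: "v1 < n" "v2 < n" "v1 \<noteq> v2" using neg d(3)[of v1] d(4)[of v1 v2] d(5)[of v1 v2] by auto
  have AD: "w < n" "w \<noteq> v1" "w \<noteq> v2" "w \<notin> B" "T w v1 = 1" if "w \<in> A" for w
  proof -
    have w: "T v1 w = 1" using that unfolding A_def by simp
    show "w < n" using w d(5)[of v1 w] by simp
    show "w \<noteq> v1" "w \<noteq> v2" using w d(3)[of v1] neg by auto
    show "T w v1 = 1" using w d(2)[of v1 w] by simp
    show "w \<notin> B" using no_short_negD(2)[OF T, of v1 w v2] w neg' d(2)[of v2 w] unfolding B_def by auto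
  qed
  have BD: "w < n" "w \<noteq> v1" "w \<noteq> v2" "T w v2 = 1" if "w \<in> B" for w
  proof -
    have w: "T v2 w = 1" using that unfolding B_def by simp
    show "w < n" using w d(5)[of v2 w] by simp
    show "w \<noteq> v1" "w \<noteq> v2" using w d(3)[of v2] neg' by auto
    show "T w v2 = 1" using w d(2)[of v2 w] by simp
  qed
  have AB: "T x y \<noteq> 1" if "x \<in> A" "y \<in> B" for x y
    using no_short_negD(3)[OF T, of v1 x y v2] that(1) BD(4)[OF that(2)] neg' unfolding A_def by auto
  have BA: "T y x \<noteq> 1" if "x \<in> A" "y \<in> B" for x y using AB[OF that] d(2)[of x y] by simp
  have v12: "v1 \<notin> A" "v2 \<notin> A" "v1 \<notin> B" "v2 \<notin> B" using AD(2,3) BD(2,3) by blast+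
  show "five_parts n A B C v1 v2"
  proof -
    have "A \<subseteq> {..<n}" "B \<subseteq> {..<n}" using AD(1) BD(1) by blast+
    moreover have "A \<inter> B = {}" using AD(4) by blast
    ultimately show ?thesis using v v12 unfolding five_parts_def C_def by blast
  qed
  show "A \<noteq> {}" using cut[of v1 "{v1}" v2] neg v(3) unfolding A_def by auto
  show "B \<noteq> {}" using cut[of v2 "{v2}" v1] neg' v(3) unfolding B_def by auto
  show "\<exists>a\<in>A. \<exists>c\<in>C. T a c = 1"
  proof -
    \<comment> \<open>The positive edge cannot start at v1, whose positive neighbours all lie inside
      the cut set.\<close>
    obtain a c where ac: "a = v1 \<or> a \<in> A" "c \<noteq> v1" "c \<notin> A" "T a c = 1"
      using cut[of v1 "insert v1 A" v2] neg v(3) v12 by auto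
    have a: "a \<in> A" using ac unfolding A_def by auto
    have "c \<noteq> v2" using AD(4)[OF a] ac(4) d(2)[of a c] unfolding B_def by auto
    moreover have "c \<notin> B" using AB[OF a] ac(4) by blast
    ultimately have "c \<in> C" using ac d(5)[of a c] unfolding C_def by simp
    then show ?thesis using a ac(4) by blast
  qed
  show "\<exists>b\<in>B. \<exists>c\<in>C. T b c = 1"
  proof -
    obtain b c where bc: "b = v2 \<or> b \<in> B" "c \<noteq> v2" "c \<notin> B" "T b c = 1"
      using cut[of v2 "insert v2 B" v1] neg' v(3) v12 by auto
    have b: "b \<in> B" using bc unfolding B_def by auto
    have "c \<noteq> v1" using AD(4)[of b] b bc(4) d(2)[of b c] unfolding A_def by auto
    moreover have "c \<notin> A" using BA[OF _ b] bc(4) by blast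
    ultimately have "c \<in> C" using bc d(5)[of b c] unfolding C_def by simp
    then show ?thesis using b bc(4) by blast
  qed
  show "T i j \<le> ext_graph A B v1 v2 i j"
  proof -
    have r: "T x y \<le> 1" for x y using d(1)[of x y] by auto
    have r0: "T x y \<le> 0" if "T x y \<noteq> 1" for x y using that d(1)[of x y] by auto
    have V1: "T v1 x \<le> of_bool (x \<in> A)" "T x v1 \<le> of_bool (x \<in> A)" for x
      using r[of v1 x] r0[of v1 x] d(2)[of v1 x] unfolding A_def by auto
    have V2: "T v2 x \<le> of_bool (x \<in> B)" "T x v2 \<le> of_bool (x \<in> B)" for x
      using r[of v2 x] r0[of v2 x] d(2)[of v2 x] unfolding B_def by auto
    consider "i = v1" | "i = v2" | "i \<noteq> v1" "i \<noteq> v2" "j = v1" | "i \<noteq> v1" "i \<noteq> v2" "j = v2"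
      | "i \<noteq> v1" "i \<noteq> v2" "j \<noteq> v1" "j \<noteq> v2" "i = j" | "i \<noteq> v1" "i \<noteq> v2" "j \<noteq> v1" "j \<noteq> v2" "i \<noteq> j" by blast
    then show ?thesis
    proof cases
      case 1
      then show ?thesis using V1[of j] neg v v12 d(3)[of v1] unfolding ext_graph_def Let_def
        by (cases "j = v2"; cases "j = v1") auto
    next
      case 2
      then show ?thesis using V2[of j] neg' v v12 d(3)[of v2] unfolding ext_graph_def Let_def
        by (cases "j = v2"; cases "j = v1") auto
    next
      case 3
      then show ?thesis using V1[of i] v v12 unfolding ext_graph_def Let_def by auto
    next
      case 4
      then show ?thesis using V2[of i] v v12 unfolding ext_graph_def Let_def by auto
    next
      case 5
      then show ?thesis using AD(4)[of i] d(3)[of i] unfolding ext_graph_def Let_def by auto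
    next
      case 6
      have "T i j \<le> 0" if "i \<in> A \<and> j \<in> B \<or> i \<in> B \<and> j \<in> A" using that AB BA r0 by blast
      then show ?thesis using 6 AD(4)[of i] AD(4)[of j] r[of i j] unfolding ext_graph_def Let_def
        by (cases "i \<in> A"; cases "i \<in> B"; cases "j \<in> A"; cases "j \<in> B") auto
    qed
  qed
qed

section \<open>The upper bound for the quadratic form and its equality case\<close>

lemma qf_switch:
  assumes "signs \<theta>"
  shows "qf n (switch \<theta> S) (\<lambda>i. of_int (\<theta> i) * x i) = qf n S x"
  unfolding qf_def switch_def
proof (intro sum.cong refl)
  fix i j
  have "real_of_int (\<theta> i * S i j * \<theta> j) * (of_int (\<theta> i) * x i) * (of_int (\<theta> j) * x j)
     = of_int (S i j) * x i * x j * of_int (\<theta> i * \<theta> i) * of_int (\<theta> j * \<theta> j)" by simp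
  then show "real_of_int (\<theta> i * S i j * \<theta> j) * (of_int (\<theta> i) * x i) * (of_int (\<theta> j) * x j) = of_int (S i j) * x i * x j"
    unfolding signsD(2)[OF assms] by simp
qed

lemma ex_abs_signs:
  fixes x :: "nat \<Rightarrow> real"
  shows "\<exists>\<theta>. signs \<theta> \<and> (\<forall>i. of_int (\<theta> i) * x i = \<bar>x i\<bar>)"
  by (rule exI[of _ "\<lambda>i. if x i < 0 then -1 else 1"]) (auto simp: signs_def)

lemma switch_switch: "switch \<eta> (switch \<theta> S) = switch (\<lambda>i. \<eta> i * \<theta> i) S"
  unfolding switch_def by (intro ext) simp

lemma signs_mult: "signs \<eta> \<Longrightarrow> signs \<theta> \<Longrightarrow> signs (\<lambda>i. \<eta> i * \<theta> i)"
proof -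
  assume "signs \<eta>" "signs \<theta>"
  then have "\<eta> i * \<theta> i \<in> {-1, 1}" for i using signsD(1)[of \<eta> i] signsD(1)[of \<theta> i] by auto
  then show ?thesis unfolding signs_def by simp
qed

text \<open>The form only grows along the chain: pass to absolute values, take the maximal
  switching, replace the graph by \<open>ext_graph\<close>, then apply the bound for the latter. If
  the ends agree, every step is an equality; the absolute values are then strictly positive, so the
  switched graph coincides with \<open>ext_graph\<close>, and its parts \<open>A\<close> and
  \<open>B\<close> are singletons.\<close>

lemma qf_le_gamma:
  assumes n: "n \<ge> 6" and S: "no_short_neg n S" and unb: "\<not> balanced n S"
  shows "qf n S x \<le> gamma_n n * (\<Sum>i<n. (x i)^2)"
    and "qf n S x = gamma_n n * (\<Sum>i<n. (x i)^2) \<Longrightarrow> k < n \<Longrightarrow> x k \<noteq> 0 \<Longrightarrow>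
      \<exists>\<theta> a b v1 v2. signs \<theta> \<and> distinct [a, b, v1, v2] \<and> {a, b, v1, v2} \<subseteq> {..<n} \<and>
        (\<forall>i<n. \<forall>j<n. switch \<theta> S i j = ext_graph {a} {b} v1 v2 i j)"
proof -
  obtain \<eta> where e: "signs \<eta>" "\<forall>i. of_int (\<eta> i) * x i = \<bar>x i\<bar>" using ex_abs_signs[of x] by (elim exE conjE)
  note S' = no_short_neg_switch[OF S e(1)]
  let ?y = "\<lambda>i. \<bar>x i\<bar>"
  have q1: "qf n S x = qf n (switch \<eta> S) ?y" using qf_switch[OF e(1), of n S x] e(2) by simp
  obtain \<theta> where t: "signs \<theta>" "qf n (switch \<eta> S) ?y \<le> qf n (switch \<theta> (switch \<eta> S)) ?y"
    and max: "flip_maximal (switch \<theta> (switch \<eta> S))"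
    using maximal_switching[OF no_short_negD(1)[OF S'] abs_ge_zero, of x] by (elim exE conjE)
  define T where "T = switch \<theta> (switch \<eta> S)"
  have sg: "signs (\<lambda>i. \<theta> i * \<eta> i)" using signs_mult[OF t(1) e(1)] .
  have T: "no_short_neg n T" unfolding T_def by (rule no_short_neg_switch[OF S' t(1)])
  have "\<exists>v1 v2. T v1 v2 = -1"
  proof (rule ccontr)
    assume "\<not> ?thesis"
    then have "balanced n S" unfolding T_def switch_switch
      by (intro balanced_if_switched_nonneg[OF no_short_negD(1)[OF S] sg]) blast
    then show False using unb by simp
  qed
  then obtain v1 v2 where neg: "T v1 v2 = -1" by blast
  define A B where "A = {w. T v1 w = 1}" and "B = {w. T v2 w = 1}"
  define C where "C = {..<n} - insert v1 (insert v2 (A \<union> B))"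
  note st = ext_graph_structure[OF T neg max[folded T_def], folded A_def B_def, folded C_def]
  have C: "C \<noteq> {}" using st(4) by blast
  have sq: "(\<Sum>i<n. (?y i)^2) = (\<Sum>i<n. (x i)^2)" by simp
  note le = qf_ext_graph_le[OF n st(1,2,3) C, of ?y, unfolded sq]
  have q2: "qf n T ?y \<le> qf n (ext_graph A B v1 v2) ?y" by (intro qf_mono st(6)) simp
  show "qf n S x \<le> gamma_n n * (\<Sum>i<n. (x i)^2)"
    using q1 t(2) q2 le(1) unfolding T_def by linarith
  assume eq: "qf n S x = gamma_n n * (\<Sum>i<n. (x i)^2)" and k: "k < n" "x k \<noteq> 0"
  have eqs: "qf n (ext_graph A B v1 v2) ?y = gamma_n n * (\<Sum>i<n. (x i)^2)" "qf n T ?y = qf n (ext_graph A B v1 v2) ?y"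
    using eq q1 t(2) q2 le(1) unfolding T_def by linarith+
  have pos: "card A = 1 \<and> card B = 1 \<and> (\<forall>i<n. ?y i > 0)" by (rule le(2)[OF eqs(1) _ k(1)]) (use k in simp_all)
  obtain a b where ab: "A = {a}" "B = {b}" using pos by (metis card_1_singletonE)
  have "T i j = ext_graph A B v1 v2 i j" if "i < n" "j < n" for i j
    by (rule qf_eq_imp_eq[OF st(6) _ eqs(2) that]) (use pos in simp)
  moreover have "distinct [a, b, v1, v2]" "{a, b, v1, v2} \<subseteq> {..<n}"
  proof -
    show "distinct [a, b, v1, v2]" using five_partsD[OF st(1)] unfolding ab by auto
    have "{..<n} = insert v1 (insert v2 (A \<union> (B \<union> C)))" using st(1) unfolding five_parts_def by (rule conjunct1)
    then show "{a, b, v1, v2} \<subseteq> {..<n}" unfolding ab by simp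
  qed
  ultimately show "\<exists>\<theta> a b v1 v2. signs \<theta> \<and> distinct [a, b, v1, v2] \<and> {a, b, v1, v2} \<subseteq> {..<n} \<and>
        (\<forall>i<n. \<forall>j<n. switch \<theta> S i j = ext_graph {a} {b} v1 v2 i j)"
    using sg unfolding T_def switch_switch ab
    by (intro exI[of _ "\<lambda>i. \<theta> i * \<eta> i"] exI[of _ a] exI[of _ b] exI[of _ v1] exI[of _ v2] conjI allI impI)
qed

section \<open>Lower bound on the eigenvalues\<close>

definition neg_edge :: "(nat \<Rightarrow> nat \<Rightarrow> int) \<Rightarrow> nat \<Rightarrow> nat \<Rightarrow> int" where
  "neg_edge S i j = of_bool (S i j = -1)"

lemma neg_edge_01: "0 \<le> neg_edge S i j" "neg_edge S i j \<le> 1"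
  unfolding neg_edge_def by simp_all

lemma neg_edge_sym: "signed_graph n S \<Longrightarrow> neg_edge S i j = neg_edge S j i"
  unfolding neg_edge_def using signed_graphD(2)[of n S i j] by simp

lemma neg_edge_triangle_free:
  assumes "no_short_neg n S"
  shows "neg_edge S i j + neg_edge S j k + neg_edge S k i \<le> 2"
  using no_short_negD(2)[OF assms, of i j k] unfolding neg_edge_def by auto

text \<open>No vertex is joined negatively to both ends of a negative edge, so the two negative
  neighbourhoods are disjoint.\<close>

lemma neg_edge_degree_sum:
  assumes S: "no_short_neg n S" and ij: "neg_edge S i j = 1"
  shows "(\<Sum>k<n. neg_edge S i k) + (\<Sum>k<n. neg_edge S j k) \<le> int n"
proof -
  have "(\<Sum>k<n. neg_edge S i k + neg_edge S j k) \<le> (\<Sum>k<n. 1)"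
  proof (rule sum_mono)
    fix k
    show "neg_edge S i k + neg_edge S j k \<le> 1"
      using neg_edge_triangle_free[OF S, of i j k] ij neg_edge_sym[OF no_short_negD(1)[OF S], of i k] by simp
  qed
  then show ?thesis by (simp add: sum.distrib)
qed

text \<open>The double sum counts walks of length two from \<open>k\<close> along negative edges, a
  row sum of the squared matrix. Every negative neighbour of \<open>k\<close> has degree at most n -
  d(k), so the count is at most d(k)(n - d(k)).\<close>

lemma neg_walks_le_quarter_square:
  assumes S: "no_short_neg n S"
  shows "4 * (\<Sum>i<n. \<Sum>j<n. neg_edge S k i * neg_edge S i j) \<le> int n ^ 2"
proof -
  define d where "d i = (\<Sum>j<n. neg_edge S i j)" for i
  have "(\<Sum>i<n. \<Sum>j<n. neg_edge S k i * neg_edge S i j) = (\<Sum>i<n. neg_edge S k i * d i)"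
    unfolding d_def by (simp add: sum_distrib_left)
  also have "\<dots> \<le> (\<Sum>i<n. neg_edge S k i * (int n - d k))"
  proof (rule sum_mono)
    fix i
    have "neg_edge S k i = 0 \<or> neg_edge S k i = 1" unfolding neg_edge_def by simp
    then show "neg_edge S k i * d i \<le> neg_edge S k i * (int n - d k)"
      using neg_edge_degree_sum[OF S, of k i] unfolding d_def by auto
  qed
  also have "\<dots> = d k * (int n - d k)" unfolding d_def by (simp add: sum_distrib_right)
  finally have "4 * (\<Sum>i<n. \<Sum>j<n. neg_edge S k i * neg_edge S i j) \<le> 4 * (d k * (int n - d k))" by simp
  also have "\<dots> = int n ^ 2 - (int n - 2 * d k)^2" by (simp add: power2_eq_square algebra_simps)
  also have "\<dots> \<le> int n ^ 2" by simp
  finally show ?thesis .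
qed

text \<open>As the negative edges form a triangle-free graph, each of them meets the neighbourhood of k at most once.\<close>
lemma neg_walks_le_edges:
  assumes S: "no_short_neg n S"
  shows "2 * (\<Sum>i<n. \<Sum>j<n. neg_edge S k i * neg_edge S i j) \<le> (\<Sum>i<n. \<Sum>j<n. neg_edge S i j)"
proof -
  note sym = neg_edge_sym[OF no_short_negD(1)[OF S]]
  let ?R = "\<Sum>i<n. \<Sum>j<n. neg_edge S k i * neg_edge S i j"
  have "?R = (\<Sum>j<n. \<Sum>i<n. neg_edge S k i * neg_edge S i j)" by (rule sum.swap)
  then have "2 * ?R = (\<Sum>i<n. \<Sum>j<n. neg_edge S k i * neg_edge S i j + neg_edge S k j * neg_edge S j i)"
    by (simp add: sum.distrib)
  also have "\<dots> \<le> (\<Sum>i<n. \<Sum>j<n. neg_edge S i j)"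
  proof (intro sum_mono)
    fix i j
    have "neg_edge S i j = 0 \<or> neg_edge S i j = 1" unfolding neg_edge_def by simp
    then show "neg_edge S k i * neg_edge S i j + neg_edge S k j * neg_edge S j i \<le> neg_edge S i j"
      using neg_edge_triangle_free[OF S, of k i j] sym[of i j] sym[of k j] by auto
  qed
  finally show ?thesis .
qed

section \<open>Negative pentagons and the case of six vertices\<close>

lemma unit_product_eq_1:
  fixes x :: int
  shows "\<bar>x\<bar> = 1 \<Longrightarrow> x \<noteq> -1 \<Longrightarrow> x = 1" by simp

text \<open>A chord cuts the pentagon into a triangle and a quadrangle. The chord counts twice in
  the product of their signs, so one of them would be negative.\<close>

lemma pentagon_chord:
  assumes S: "no_short_neg n S" and pent: "S p q * S q r * S r s * S s t * S t p = -1"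
  shows "S p r = 0"
proof (rule ccontr)
  assume nz: "S p r \<noteq> 0"
  note d = signed_graphD[OF no_short_negD(1)[OF S]]
  have abs: "\<bar>S u v\<bar> = 1" if "S u v \<noteq> 0" for u v using d(1)[of u v] that by auto
  have nzs: "S p q \<noteq> 0" "S q r \<noteq> 0" "S r s \<noteq> 0" "S s t \<noteq> 0" "S t p \<noteq> 0" using pent by auto
  have rp: "S r p = S p r" by (rule d(2))
  have "S p q * S q r * S r p = 1"
    by (rule unit_product_eq_1) (use no_short_negD(2)[OF S, of p q r] abs nz nzs rp in \<open>simp_all add: abs_mult\<close>)
  moreover have "S p r * S r s * S s t * S t p = 1"
    by (rule unit_product_eq_1) (use no_short_negD(3)[OF S, of p r s t] abs nz nzs rp in \<open>simp_all add: abs_mult\<close>)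
  ultimately have "(S p q * S q r * S r p) * (S p r * S r s * S s t * S t p) = 1" by simp
  moreover have "(S p q * S q r * S r p) * (S p r * S r s * S s t * S t p)
    = (S p q * S q r * S r s * S s t * S t p) * (S p r * S p r)" unfolding rp by simp
  moreover have "S p r * S p r = 1" using abs[OF nz] abs_mult_self_eq[of "S p r"] by simp
  ultimately show False using pent by simp
qed

text \<open>Otherwise \<open>z\<close> divides the pentagon into one triangle and two quadrangles.
  Each edge at \<open>z\<close> lies in two of them, so their signs multiply to the sign of the
  pentagon and one of them would be negative.\<close>

lemma pentagon_neighbours:
  assumes S: "no_short_neg n S" and pent: "S p q * S q r * S r s * S s t * S t p = -1"
  shows "S z p = 0 \<or> S z q = 0 \<or> S z s = 0"
proof (rule ccontr)
  assume "\<not> ?thesis"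
  then have nz: "S z p \<noteq> 0" "S z q \<noteq> 0" "S z s \<noteq> 0" by simp_all
  note d = signed_graphD[OF no_short_negD(1)[OF S]]
  have abs: "\<bar>S u v\<bar> = 1" if "S u v \<noteq> 0" for u v using d(1)[of u v] that by auto
  have sq: "S u v * S u v = 1" if "S u v \<noteq> 0" for u v using abs[OF that] abs_mult_self_eq[of "S u v"] by simp
  have nzs: "S p q \<noteq> 0" "S q r \<noteq> 0" "S r s \<noteq> 0" "S s t \<noteq> 0" "S t p \<noteq> 0" using pent by auto
  have sym: "S p z = S z p" "S q z = S z q" "S s z = S z s" by (rule d(2))+
  have "S z p * S p q * S q z = 1"
    by (rule unit_product_eq_1) (use no_short_negD(2)[OF S, of z p q] abs nz nzs sym in \<open>simp_all add: abs_mult\<close>)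
  moreover have "S z q * S q r * S r s * S s z = 1"
    by (rule unit_product_eq_1) (use no_short_negD(3)[OF S, of z q r s] abs nz nzs sym in \<open>simp_all add: abs_mult\<close>)
  moreover have "S z s * S s t * S t p * S p z = 1"
    by (rule unit_product_eq_1) (use no_short_negD(3)[OF S, of z s t p] abs nz nzs sym in \<open>simp_all add: abs_mult\<close>)
  ultimately have "(S z p * S p q * S q z) * (S z q * S q r * S r s * S s z) * (S z s * S s t * S t p * S p z) = 1" by simp
  moreover have "(S z p * S p q * S q z) * (S z q * S q r * S r s * S s z) * (S z s * S s t * S t p * S p z)
    = (S p q * S q r * S r s * S s t * S t p) * (S z p * S z p) * (S z q * S z q) * (S z s * S z s)" unfolding sym by simp
  ultimately show False using pent sq[OF nz(1)] sq[OF nz(2)] sq[OF nz(3)] by simp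
qed

lemma sum_six:
  fixes f :: "nat \<Rightarrow> 'a :: comm_monoid_add"
  assumes "distinct [p,q,r,s,t,z]" "{p,q,r,s,t,z} \<subseteq> {..<6}"
  shows "sum f {..<6} = f p + (f q + (f r + (f s + (f t + f z))))"
proof -
  have "card {p,q,r,s,t,z} = 6" using assms(1) by simp
  then have "{..<6} = {p,q,r,s,t,z}" using card_subset_eq[OF _ assms(2)] by simp
  then show ?thesis using assms(1) by simp
qed

text \<open>There are no chords, so all edges lie on the pentagon or join it to the sixth vertex
  \<open>z\<close>; \<open>P\<close> and \<open>Z\<close> count the negative ones of each kind. The
  five triangles at \<open>z\<close> give 2Z + P \<le> 10, and the five rotations of
  \<open>pentagon_neighbours\<close> give 3Z \<le> 10. The ordered-pair sum counts every edge twice,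
  whence 14.\<close>

lemma pentagon_neg_edges_le:
  assumes S: "no_short_neg 6 S" and pent: "S p q * S q r * S r s * S s t * S t p = -1"
    and dist: "distinct [p,q,r,s,t]"
  shows "(\<Sum>i<6. \<Sum>j<6. neg_edge S i j) \<le> 14"
proof -
  note d = signed_graphD[OF no_short_negD(1)[OF S]]
  have nzs: "S p q \<noteq> 0" "S q r \<noteq> 0" "S r s \<noteq> 0" "S s t \<noteq> 0" "S t p \<noteq> 0" using pent by auto
  have sub: "{p,q,r,s,t} \<subseteq> {..<6}" using nzs d(4) by auto
  have "card {p,q,r,s,t} = 5" using dist by simp
  then have "card ({..<6} - {p,q,r,s,t}) = 1" using card_Diff_subset[OF _ sub] by simp
  then have "{..<6} - {p,q,r,s,t} \<noteq> {}" by (intro notI) simp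
  then obtain z where z: "z < 6" "z \<notin> {p,q,r,s,t}" by auto
  have rot: "S q r * S r s * S s t * S t p * S p q = -1" "S r s * S s t * S t p * S p q * S q r = -1"
    "S s t * S t p * S p q * S q r * S r s = -1" "S t p * S p q * S q r * S r s * S s t = -1"
    using pent by (simp_all add: mult_ac)
  have chord: "S p r = 0" "S q s = 0" "S r t = 0" "S s p = 0" "S t q = 0"
    using pentagon_chord[OF S pent] pentagon_chord[OF S rot(1)] pentagon_chord[OF S rot(2)]
      pentagon_chord[OF S rot(3)] pentagon_chord[OF S rot(4)] by simp_all
  define h where "h = neg_edge S"
  have sym: "h u v = h v u" for u v unfolding h_def by (rule neg_edge_sym[OF no_short_negD(1)[OF S]])
  have z0: "h u v = 0" if "S u v = 0" for u v using that unfolding h_def neg_edge_def by simp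
  have ch: "h p r = 0" "h q s = 0" "h r t = 0" "h s p = 0" "h t q = 0" using chord z0 by simp_all
  have dg: "h u u = 0" for u using z0 d(3) by simp
  have nb: "h z u + h z v + h z w \<le> 2" if "S z u = 0 \<or> S z v = 0 \<or> S z w = 0" for u v w
    using that z0[of z u] z0[of z v] z0[of z w] neg_edge_01(2)[of S z u] neg_edge_01(2)[of S z v] neg_edge_01(2)[of S z w]
    unfolding h_def[symmetric] by linarith
  have N: "h z p + h z q + h z s \<le> 2" "h z q + h z r + h z t \<le> 2" "h z r + h z s + h z p \<le> 2"
    "h z s + h z t + h z q \<le> 2" "h z t + h z p + h z r \<le> 2"
    using nb[OF pentagon_neighbours[OF S pent]] nb[OF pentagon_neighbours[OF S rot(1)]] nb[OF pentagon_neighbours[OF S rot(2)]]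
      nb[OF pentagon_neighbours[OF S rot(3)]] nb[OF pentagon_neighbours[OF S rot(4)]] by simp_all
  have tri: "h z u + h u v + h z v \<le> 2" for u v
    using neg_edge_triangle_free[OF S, of z u v] sym[of v z] unfolding h_def by simp
  define P where "P = h p q + h q r + h r s + h s t + h t p"
  define Z where "Z = h z p + h z q + h z r + h z s + h z t"
  have "2 * Z + P = (h z p + h p q + h z q) + (h z q + h q r + h z r) + (h z r + h r s + h z s)
      + (h z s + h s t + h z t) + (h z t + h t p + h z p)" unfolding P_def Z_def by simp
  then have "2 * Z + P \<le> 10" using tri[of p q] tri[of q r] tri[of r s] tri[of s t] tri[of t p] by linarith
  moreover have "3 * Z = (h z p + h z q + h z s) + (h z q + h z r + h z t) + (h z r + h z s + h z p)
      + (h z s + h z t + h z q) + (h z t + h z p + h z r)" unfolding Z_def by simp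
  then have "3 * Z \<le> 10" using N by linarith
  moreover have "P \<le> 5" unfolding P_def h_def
    using neg_edge_01(2)[of S p q] neg_edge_01(2)[of S q r] neg_edge_01(2)[of S r s] neg_edge_01(2)[of S s t] neg_edge_01(2)[of S t p] by linarith
  \<comment> \<open>By integrality Z \<le> 3; here Z = 3 leaves P \<le> 4, and Z \<le> 2 is combined
    with P \<le> 5.\<close>
  ultimately have "P + Z \<le> 7" by presburger
  moreover have "(\<Sum>i<6. \<Sum>j<6. h i j) = 2 * (P + Z)"
  proof -
    have "distinct [p,q,r,s,t,z]" "{p,q,r,s,t,z} \<subseteq> {..<6}" using dist z sub by auto
    note s6 = sum_six[OF this]
    have "h r p = 0" "h s q = 0" "h t r = 0" "h p s = 0" "h q t = 0"
      using ch sym[of p r] sym[of q s] sym[of r t] sym[of s p] sym[of t q] by simp_all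
    moreover have "h q p = h p q" "h r q = h q r" "h s r = h r s" "h t s = h s t" "h p t = h t p"
      "h p z = h z p" "h q z = h z q" "h r z = h z r" "h s z = h z s" "h t z = h z t" by (rule sym)+
    ultimately show ?thesis unfolding s6 P_def Z_def by (simp add: dg ch)
  qed
  ultimately show ?thesis unfolding h_def by simp
qed

text \<open>For the zero vector the condition on the form is vacuous, so the switching maximises the
  sum of entries alone.\<close>

lemma ex_flip_maximal_negative_edge:
  assumes S: "no_short_neg n S" and unb: "\<not> balanced n S"
  obtains \<theta> v1 v2 where "signs \<theta>" "switch \<theta> S v1 v2 = -1" "flip_maximal (switch \<theta> S)"
proof -
  obtain \<theta> where t: "signs \<theta>" "qf n S (\<lambda>_. 0) \<le> qf n (switch \<theta> S) (\<lambda>_. 0)" "flip_maximal (switch \<theta> S)"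
    using maximal_switching[OF no_short_negD(1)[OF S], of "\<lambda>_. 0", OF order_refl] by (elim exE conjE)
  have "\<exists>v1 v2. switch \<theta> S v1 v2 = -1"
  proof (rule ccontr)
    assume "\<not> ?thesis"
    then have "balanced n S" by (intro balanced_if_switched_nonneg[OF no_short_negD(1)[OF S] t(1)]) blast
    then show False using unb by simp
  qed
  then show ?thesis using that[OF t(1) _ t(3)] by blast
qed

lemma pentagon_switch:
  assumes "signs \<theta>"
  shows "switch \<theta> S p q * switch \<theta> S q r * switch \<theta> S r s * switch \<theta> S s t * switch \<theta> S t p
    = S p q * S q r * S r s * S s t * S t p"
proof -
  note d = signsD(2)[OF assms]
  have "switch \<theta> S p q * switch \<theta> S q r * switch \<theta> S r s * switch \<theta> S s t * switch \<theta> S t p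
    = S p q * S q r * S r s * S s t * S t p * (\<theta> p * \<theta> p) * (\<theta> q * \<theta> q) * (\<theta> r * \<theta> r) * (\<theta> s * \<theta> s) * (\<theta> t * \<theta> t)"
    unfolding switch_def by simp
  then show ?thesis unfolding d by simp
qed

lemma switch_eq_0_iff: "signs \<theta> \<Longrightarrow> switch \<theta> S i j = 0 \<longleftrightarrow> S i j = 0"
  using signsD(1)[of \<theta> i] signsD(1)[of \<theta> j] unfolding switch_def by auto

text \<open>Without a negative pentagon, the positive edges from \<open>A\<close> to
  \<open>C\<close> and from \<open>B\<close> to \<open>C\<close> end at different vertices of
  \<open>C\<close>. Together with v1 and v2 this uses up all six vertices, and the graph turns out
  to be a hexagon: 6 edges, hence 12 ordered pairs.\<close>

lemma six_vertices_pentagon_or_hexagon: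
  assumes S: "no_short_neg 6 S" and unb: "\<not> balanced 6 S"
  shows "(\<exists>p q r s t. distinct [p,q,r,s,t] \<and> S p q * S q r * S r s * S s t * S t p = -1) \<or>
    (\<Sum>i<6. \<Sum>j<6. of_bool (S i j \<noteq> 0)) \<le> (12::int)"
proof -
  obtain \<theta> v1 v2 where t: "signs \<theta>" and neg: "switch \<theta> S v1 v2 = -1" and max: "flip_maximal (switch \<theta> S)"
    using ex_flip_maximal_negative_edge[OF S unb] by blast
  define T where "T = switch \<theta> S"
  have T: "no_short_neg 6 T" unfolding T_def by (rule no_short_neg_switch[OF S t])
  note d = signed_graphD[OF no_short_negD(1)[OF T]]
  note neg = neg[folded T_def] and max = max[folded T_def]
  define A B where "A = {w. T v1 w = 1}" and "B = {w. T v2 w = 1}"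
  define C where "C = {..<6} - insert v1 (insert v2 (A \<union> B))"
  note st = ext_graph_structure[OF T neg max, folded A_def B_def, folded C_def]
  note parts = five_partsD[OF st(1)]
  have neg': "T v2 v1 = -1" using neg d(2)[of v1 v2] by simp
  show ?thesis
  proof (cases "\<exists>p q r s t. distinct [p,q,r,s,t] \<and> S p q * S q r * S r s * S s t * S t p = -1")
    case True
    then show ?thesis by (rule disjI1)
  next
    case nopent: False
    have np: False if "distinct [p,q,r,s,t]" "T p q * T q r * T r s * T s t * T t p = -1" for p q r s t
    proof -
      have "S p q * S q r * S r s * S s t * S t p = -1"
        using that(2) pentagon_switch[OF \<open>signs \<theta>\<close>, of S p q r s t] unfolding T_def by simp
      with that(1) have "\<exists>p q r s t. distinct [p,q,r,s,t] \<and> S p q * S q r * S r s * S s t * S t p = -1"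
        by (intro exI conjI)
      with nopent show False by (rule notE)
    qed
    obtain a c where ac: "a \<in> A" "c \<in> C" "T a c = 1" using st(4) by blast
    obtain b e where be: "b \<in> B" "e \<in> C" "T b e = 1" using st(5) by blast
    have va: "T v1 a = 1" and vb: "T v2 b = 1" using ac be unfolding A_def B_def by simp_all
    have vb': "T b v2 = 1" and va': "T a v1 = 1" using va vb d(2)[of b v2] d(2)[of a v1] by simp_all
    have ca: "T c a = 1" and eb: "T e b = 1" using ac be d(2)[of c a] d(2)[of e b] by simp_all
    have ne: "v1 \<noteq> v2" "a \<noteq> v1" "a \<noteq> v2" "b \<noteq> v1" "b \<noteq> v2" "c \<noteq> v1" "c \<noteq> v2" "e \<noteq> v1" "e \<noteq> v2" "a \<noteq> b" "a \<noteq> c" "a \<noteq> e" "b \<noteq> c" "b \<noteq> e"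
      using parts(1) parts(6)[OF ac(1)] parts(7)[OF be(1)] parts(8)[OF ac(2)] parts(8)[OF be(2)] ac(1) be(1) by auto
    \<comment> \<open>A common end in \<open>C\<close> would close the pentagon v1, a, c, b, v2,
      whose only negative edge is v1 v2.\<close>
    have ce: "c \<noteq> e" using np[of v1 a c b v2] ne va ac(3) eb vb' neg' by auto
    have nA: "T v1 b \<noteq> 1" "T v1 c \<noteq> 1" "T v1 e \<noteq> 1" "T v2 a \<noteq> 1" "T v2 c \<noteq> 1" "T v2 e \<noteq> 1"
      using parts(6)[OF ac(1)] parts(7)[OF be(1)] parts(8)[OF ac(2)] parts(8)[OF be(2)] unfolding A_def B_def by simp_all
    have nab: "T a b \<noteq> 1" using no_short_negD(3)[OF T, of v1 a b v2] va vb' neg' by auto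
    have nae: "T a e \<noteq> 1" using np[of v1 a e b v2] ne va eb vb' neg' by auto
    have ncb: "T c b \<noteq> 1" using np[of v1 a c b v2] ne va ac(3) vb' neg' by auto
    have dist: "distinct [v1,a,c,e,b,v2]" using ne ce by simp
    have sub: "{v1,a,c,e,b,v2} \<subseteq> {..<6}"
      using d(4)[of v1 v2] d(4)[of v2 v1] d(4)[of a c] d(5)[of a c] d(4)[of b e] d(5)[of b e] neg neg' ac(3) be(3) by simp
    have V: "{..<6} = {v1,a,c,e,b,v2}"
    proof -
      have "card {v1,a,c,e,b,v2} = 6" using dist by simp
      then show ?thesis using card_subset_eq[OF _ sub] by simp
    qed
    \<comment> \<open>The negative edge v1 v2 crosses this cut as well, and every crossing pair
      other than c e is already known not to be a positive edge.\<close>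
    have ce1: "T c e = 1"
    proof -
      obtain x y where xy: "x \<in> {v1,a,c}" "y \<notin> {v1,a,c}" "T x y = 1"
        using max[unfolded flip_maximal_def, rule_format, of v1 "{v1,a,c}" v2] ne neg by auto
      have "y \<in> {..<6}" using d(5)[of x y] xy by simp
      then have "y = e \<or> y = b \<or> y = v2" using xy(2) unfolding V by auto
      moreover have "T a v2 \<noteq> 1" "T c v2 \<noteq> 1" using nA d(2)[of a v2] d(2)[of c v2] by simp_all
      ultimately show ?thesis using xy neg nA nab nae ncb by auto
    qed
    then have ec1: "T e c = 1" using d(2)[of e c] by simp
    have zero: "T x y = 0" if "T x y \<noteq> 1" "T x y \<noteq> -1" for x y using that d(1)[of x y] by auto
    \<comment> \<open>The vertices v1, a, c, e, b, v2 form a path of positive edges. A negative edge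
      between two nonconsecutive vertices other than the ends would close a negative cycle of length
      3, 4 or 5 with the path.\<close>
    have z: "T a e = 0" "T c b = 0" "T v1 c = 0" "T v2 e = 0" "T v1 e = 0" "T v2 c = 0" "T a b = 0" "T v1 b = 0" "T v2 a = 0"
    proof -
      have "T a e \<noteq> -1" using no_short_negD(2)[OF T, of a c e] ac(3) ce1 d(2)[of e a] by auto
      then show "T a e = 0" using zero nae by simp
      have "T c b \<noteq> -1" using no_short_negD(2)[OF T, of c e b] ce1 eb d(2)[of b c] by auto
      then show "T c b = 0" using zero ncb by simp
      have "T v1 c \<noteq> -1" using no_short_negD(2)[OF T, of v1 a c] va ac(3) d(2)[of c v1] by auto
      then show "T v1 c = 0" using zero nA by simp
      have "T v2 e \<noteq> -1" using no_short_negD(2)[OF T, of v2 b e] vb be(3) d(2)[of e v2] by auto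
      then show "T v2 e = 0" using zero nA by simp
      have "T v1 e \<noteq> -1" using no_short_negD(3)[OF T, of v1 a c e] va ac(3) ce1 d(2)[of e v1] by auto
      then show "T v1 e = 0" using zero nA by simp
      have "T v2 c \<noteq> -1" using no_short_negD(3)[OF T, of v2 b e c] vb be(3) ec1 d(2)[of c v2] by auto
      then show "T v2 c = 0" using zero nA by simp
      have "T a b \<noteq> -1" using no_short_negD(3)[OF T, of a c e b] ac(3) ce1 eb d(2)[of b a] by auto
      then show "T a b = 0" using zero nab by simp
      have "T v1 b \<noteq> -1" using np[of v1 a c e b] ne ce va ac(3) ce1 eb d(2)[of b v1] by auto
      then show "T v1 b = 0" using zero nA by simp
      have "T v2 a \<noteq> -1" using np[of v2 b e c a] ne ce vb be(3) ec1 ca d(2)[of a v2] by auto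
      then show "T v2 a = 0" using zero nA by simp
    qed
    have z': "T e a = 0" "T b c = 0" "T c v1 = 0" "T e v2 = 0" "T e v1 = 0" "T c v2 = 0" "T b a = 0" "T b v1 = 0" "T a v2 = 0"
      using z d(2)[of e a] d(2)[of b c] d(2)[of c v1] d(2)[of e v2] d(2)[of e v1] d(2)[of c v2] d(2)[of b a] d(2)[of b v1] d(2)[of a v2]
      by simp_all
    have "(\<Sum>i<6. \<Sum>j<6. of_bool (T i j \<noteq> 0)) \<le> (12::int)"
      unfolding sum_six[OF dist sub] using z z' d(3) va va' vb vb' ac(3) ca be(3) eb ce1 ec1 neg neg' by simp
    then show ?thesis unfolding T_def switch_eq_0_iff[OF t] by (rule disjI2)
  qed
qed

text \<open>The bound is needed for an arbitrary switching, because the signs of an eigenvector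
  choose \<open>\<eta>\<close>. The sign of the pentagon and the set of edges are both invariant
  under switching.\<close>

lemma six_vertices_neg_edges_le:
  assumes S: "no_short_neg 6 S" and unb: "\<not> balanced 6 S" and e: "signs \<eta>"
  shows "(\<Sum>i<6. \<Sum>j<6. neg_edge (switch \<eta> S) i j) \<le> 14"
  using six_vertices_pentagon_or_hexagon[OF S unb]
proof (elim disjE exE conjE)
  fix p q r s t
  assume "distinct [p,q,r,s,t]" "S p q * S q r * S r s * S s t * S t p = -1"
  then show ?thesis
    using pentagon_neg_edges_le[OF no_short_neg_switch[OF S e], of p q r s t] unfolding pentagon_switch[OF e] by simp
next
  assume *: "(\<Sum>i<6. \<Sum>j<6. of_bool (S i j \<noteq> 0)) \<le> (12::int)"
  have "neg_edge (switch \<eta> S) i j \<le> of_bool (S i j \<noteq> 0)" for i j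
    unfolding neg_edge_def using switch_eq_0_iff[OF e, of S i j] by auto
  then have "(\<Sum>i<6. \<Sum>j<6. neg_edge (switch \<eta> S) i j) \<le> (\<Sum>i<6. \<Sum>j<6. of_bool (S i j \<noteq> 0))"
    by (intro sum_mono)
  then show ?thesis using * by simp
qed

text \<open>With \<open>\<mu> = - e\<close> and \<open>y\<close> the absolute values of the
  eigenvector, \<open>\<mu> * y\<close> is bounded entrywise by the negative-edge matrix applied to
  \<open>y\<close>. Two such steps, read at a largest entry of \<open>y\<close>, bound
  \<open>\<mu>^2\<close> by the number of negative walks of length two from that vertex. Strictness
  leaves only the upper end for the equality case.\<close>

lemma eigenvalue_gt_neg_gamma:
  assumes n: "n \<ge> 6" and S: "no_short_neg n S" and unb: "\<not> balanced n S" and ev: "eigenpair n S e x"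
  shows "- gamma_n n < e"
proof (cases "e \<ge> 0")
  case True
  then show ?thesis using gamma_n_ge_2[OF n] by simp
next
  case False
  define \<mu> where "\<mu> = - e"
  have mu: "\<mu> > 0" using False unfolding \<mu>_def by simp
  obtain \<eta> where t: "signs \<eta>" "\<forall>i. of_int (\<eta> i) * x i = \<bar>x i\<bar>" using ex_abs_signs[of x] by (elim exE conjE)
  define B where "B = switch \<eta> S"
  have B: "no_short_neg n B" unfolding B_def by (rule no_short_neg_switch[OF S t(1)])
  define y where "y i = \<bar>x i\<bar>" for i
  have y0: "y i \<ge> 0" for i unfolding y_def by simp
  define H where "H i j = real_of_int (neg_edge B i j)" for i j
  have H0: "H i j \<ge> 0" for i j unfolding H_def neg_edge_def by simp
  have step: "\<mu> * y i \<le> (\<Sum>j<n. H i j * y j)" if i: "i < n" for i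
  proof -
    have xe: "x j = of_int (\<eta> j) * y j" for j
    proof -
      have "of_int (\<eta> j) * y j = of_int (\<eta> j * \<eta> j) * x j" unfolding y_def t(2)[rule_format, symmetric] by simp
      then show ?thesis unfolding signsD(2)[OF t(1)] by simp
    qed
    have "\<mu> * y i = of_int (\<eta> i) * - (e * x i)" unfolding \<mu>_def y_def t(2)[rule_format, symmetric] by simp
    also have "e * x i = (\<Sum>j<n. of_int (S i j) * x j)" using ev i unfolding eigenpair_def by simp
    also have "of_int (\<eta> i) * - (\<Sum>j<n. of_int (S i j) * x j) = (\<Sum>j<n. - of_int (B i j) * y j)"
      unfolding B_def switch_def by (subst xe) (simp add: sum_distrib_left sum_negf mult_ac)
    also have "\<dots> \<le> (\<Sum>j<n. H i j * y j)"
    proof (intro sum_mono mult_right_mono y0)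
      fix j
      show "- of_int (B i j) \<le> H i j"
        using signed_graphD(1)[OF no_short_negD(1)[OF B], of i j] unfolding H_def neg_edge_def by auto
    qed
    finally show ?thesis .
  qed
  have ne: "finite (y ` {..<n})" "y ` {..<n} \<noteq> {}" using n by (auto simp: lessThan_empty_iff)
  obtain k where k: "k < n" "y k = Max (y ` {..<n})" using Max_in[OF ne] by auto
  have le: "y j \<le> y k" if "j < n" for j unfolding k(2) using that ne(1) by simp
  have yk: "y k > 0"
  proof -
    obtain i where "i < n" "x i \<noteq> 0" using ev unfolding eigenpair_def by blast
    then show ?thesis using le[of i] unfolding y_def by simp
  qed
  define R where "R = (\<Sum>i<n. \<Sum>j<n. neg_edge B k i * neg_edge B i j)"
  have "\<mu>^2 * y k = \<mu> * (\<mu> * y k)" by (simp add: power2_eq_square)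
  also have "\<dots> \<le> \<mu> * (\<Sum>i<n. H k i * y i)" using step[OF k(1)] mu by simp
  also have "\<dots> = (\<Sum>i<n. H k i * (\<mu> * y i))" by (simp add: sum_distrib_left mult_ac)
  also have "\<dots> \<le> (\<Sum>i<n. H k i * (\<Sum>j<n. H i j * y j))"
    by (intro sum_mono mult_left_mono step H0) simp
  also have "\<dots> \<le> (\<Sum>i<n. H k i * (\<Sum>j<n. H i j * y k))"
    by (intro sum_mono mult_left_mono le H0) simp
  also have "\<dots> = of_int R * y k" unfolding R_def H_def by (simp add: sum_distrib_left sum_distrib_right mult_ac)
  finally have R: "\<mu>^2 \<le> of_int R" using yk by simp
  have "of_int R < gamma_n n ^ 2"
  proof (cases "n = 6")
    case True
    have "2 * R \<le> 14" using neg_walks_le_edges[OF B, of k] six_vertices_neg_edges_le[OF S[unfolded True] unb[unfolded True] t(1)]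
      unfolding R_def B_def True by linarith
    then have "real_of_int R \<le> 7" by simp
    then show ?thesis using gamma_n_square_gt(1)[OF n True] by simp
  next
    case False
    have "4 * R \<le> int n ^ 2" using neg_walks_le_quarter_square[OF B, of k] unfolding R_def .
    then have "real_of_int (4 * R) \<le> real_of_int (int n ^ 2)" by (simp only: of_int_le_iff)
    then show ?thesis using gamma_n_square_gt(2)[OF n] False n by simp
  qed
  with R have "\<mu>^2 < gamma_n n ^ 2" by simp
  then have "\<mu> < gamma_n n" using gamma_n_ge_2[OF n] by (auto intro: power2_less_imp_less)
  then show ?thesis unfolding \<mu>_def by simp
qed

section \<open>The spectral radius of Gamma_n\<close>

lemma Gamma_n_eq_ext_graph:
  assumes n: "n \<ge> 6" and ij: "i < n" "j < n"
  shows "Gamma_n n i j = ext_graph {0} {1} (n - 2) (n - 1) i j"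
proof -
  define v1 v2 where "v1 = n - 2" and "v2 = n - 1"
  have ne: "v1 \<noteq> 0" "v1 \<noteq> 1" "v2 \<noteq> 0" "v2 \<noteq> 1" "v1 \<noteq> v2" "0 \<noteq> v1" "1 \<noteq> v1" "0 \<noteq> v2" "1 \<noteq> v2" "v2 \<noteq> v1"
    using n unfolding v1_def v2_def by linarith+
  have lt: "k < v1 \<longleftrightarrow> k \<noteq> v1 \<and> k \<noteq> v2" if "k < n" for k using that unfolding v1_def v2_def by linarith
  have G: "Gamma_n n i j =
    (if (i \<noteq> v1 \<and> i \<noteq> v2) \<and> (j \<noteq> v1 \<and> j \<noteq> v2) \<and> i \<noteq> j \<and> \<not> (i = 0 \<and> j = 1 \<or> i = 1 \<and> j = 0) then 1
      else if i = v1 \<and> j = v2 \<or> i = v2 \<and> j = v1 then -1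
      else if i = v1 \<and> j = 0 \<or> i = 0 \<and> j = v1 then 1
      else if i = v2 \<and> j = 1 \<or> i = 1 \<and> j = v2 then 1 else 0)"
    unfolding Gamma_n_def doubleton_eq_iff v1_def[symmetric] v2_def[symmetric]
    unfolding lt[OF ij(1)] lt[OF ij(2)] by (simp only: conj_assoc)
  consider "i = v1" | "i = v2" | "i \<noteq> v1" "i \<noteq> v2" "i = 0" | "i \<noteq> v1" "i \<noteq> v2" "i = 1" | "i \<noteq> v1" "i \<noteq> v2" "i \<noteq> 0" "i \<noteq> 1" by blast
  then show ?thesis
  proof cases
    case 1 then show ?thesis using ne unfolding G ext_graph_def Let_def v1_def[symmetric] v2_def[symmetric] by simp
  next
    case 2 then show ?thesis using ne unfolding G ext_graph_def Let_def v1_def[symmetric] v2_def[symmetric] by simp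
  next
    case 3 then show ?thesis using ne unfolding G ext_graph_def Let_def v1_def[symmetric] v2_def[symmetric] by simp
  next
    case 4 then show ?thesis using ne unfolding G ext_graph_def Let_def v1_def[symmetric] v2_def[symmetric] by simp
  next
    case 5 then show ?thesis using ne unfolding G ext_graph_def Let_def v1_def[symmetric] v2_def[symmetric] by simp
  qed
qed

lemma five_parts_Gamma_n:
  assumes "n \<ge> 6"
  shows "five_parts n {0} {1} {2..<n - 2} (n - 2) (n - 1)"
proof -
  have "{..<n} = insert (n - 2) (insert (n - 1) ({0} \<union> ({1} \<union> {2..<n - 2})))"
  proof (rule Set.set_eqI)
    fix i
    show "i \<in> {..<n} \<longleftrightarrow> i \<in> insert (n - 2) (insert (n - 1) ({0} \<union> ({1} \<union> {2..<n - 2})))"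
      using assms by auto
  qed
  moreover have "n - 2 \<noteq> n - 1" using assms by linarith
  moreover have "n - 1 \<notin> {0} \<union> ({1} \<union> {2..<n - 2})" "n - 2 \<notin> {0} \<union> ({1} \<union> {2..<n - 2})"
    using assms by auto
  ultimately show ?thesis unfolding five_parts_def by (intro conjI) simp_all
qed

text \<open>Normalised to 1 at v1 and v2, whose rows then force l + 1 at their positive neighbours 0
  and 1. The row of any remaining vertex fixes the last value; its denominator is positive because l
  > n - 4.\<close>

definition Gamma_n_eigenvector :: "nat \<Rightarrow> nat \<Rightarrow> real" where
  "Gamma_n_eigenvector n i =
     (let l = gamma_n n in
      if i = 0 \<or> i = 1 then l + 1 else if i = n - 2 \<or> i = n - 1 then 1 else 2 * (l + 1) / (l + 5 - real n))"

lemma eigenpair_Gamma_n: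
  assumes n: "n \<ge> 6"
  shows "eigenpair n (Gamma_n n) (gamma_n n) (Gamma_n_eigenvector n)"
proof -
  define l where "l = gamma_n n"
  let ?x = "Gamma_n_eigenvector n"
  define q where "q = 2 * (l + 1) / (l + 5 - real n)"
  have l: "l + 5 - real n > 0" using gamma_n_gt[OF n] unfolding l_def by simp
  have x: "?x 0 = l + 1" "?x 1 = l + 1" "?x (n - 2) = 1" "?x (n - 1) = 1"
    using n unfolding Gamma_n_eigenvector_def l_def Let_def by auto
  have xq: "?x i = q" if "i \<in> {2..<n-2}" for i
    using n that unfolding Gamma_n_eigenvector_def q_def l_def Let_def by auto
  have sumq: "sum ?x {2..<n-2} = (real n - 4) * q"
    using xq n by (simp add: of_nat_diff)
  have sum1: "sum ?x {0} = l + 1" "sum ?x {1} = l + 1" using x by simp_all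
  have q: "q * (l + 5 - real n) = 2 * (l + 1)" using l unfolding q_def by simp
  \<comment> \<open>This is the eigenvalue equation at the vertices 0 and 1; cleared of its
    denominator it becomes the cubic.\<close>
  have root: "(real n - 4) * q + 1 = l * (l + 1)"
  proof -
    have "((real n - 4) * q + 1) * (l + 5 - real n) = (real n - 4) * (q * (l + 5 - real n)) + (l + 5 - real n)"
      by (simp add: algebra_simps)
    also have "\<dots> = l * (l + 1) * (l + 5 - real n)"
      unfolding q using gamma_n_root[OF n] unfolding l_def[symmetric] gamma_poly_def
      by (simp add: algebra_simps power2_eq_square power3_eq_cube)
    finally show ?thesis using l by simp
  qed
  have "(\<Sum>j<n. of_int (Gamma_n n i j) * ?x j) = l * ?x i" if i: "i < n" for i
  proof -
    have "(\<Sum>j<n. of_int (Gamma_n n i j) * ?x j) = (\<Sum>j<n. of_int (ext_graph {0} {1} (n - 2) (n - 1) i j) * ?x j)"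
      using Gamma_n_eq_ext_graph[OF n i] by (intro sum.cong) auto
    also have "\<dots> = of_bool (i \<noteq> n - 2 \<and> i \<noteq> n - 1) * (2 * (l + 1) + (real n - 4) * q - ?x i)
      - (of_bool (i \<in> {0}) - of_bool (i = n - 1)) * l - (of_bool (i \<in> {1}) - of_bool (i = n - 2)) * l"
      unfolding ext_graph_row_sum[OF five_parts_Gamma_n[OF n] i] sumq sum1 x by simp
    also have "\<dots> = l * ?x i"
    proof -
      have ne: "0 \<noteq> n - 2" "0 \<noteq> n - 1" "1 \<noteq> n - 2" "1 \<noteq> n - 1" "n - 2 \<noteq> 0" "n - 1 \<noteq> 0" "n - 2 \<noteq> 1" "n - 1 \<noteq> 1" "n - 2 \<noteq> n - 1" "n - 1 \<noteq> n - 2"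
        using n by linarith+
      have "i = 0 \<or> i = 1 \<or> i = n - 2 \<or> i = n - 1 \<or> (2 \<le> i \<and> i < n - 2)" using i by linarith
      then consider "i = 0" | "i = 1" | "i = n - 2" | "i = n - 1" | "i \<in> {2..<n-2}" by (metis atLeastLessThan_iff)
      then show ?thesis
      proof cases
        case 1 then show ?thesis using ne root unfolding 1 x by (simp add: algebra_simps)
      next
        case 2 then show ?thesis using ne root unfolding 2 x by (simp add: algebra_simps)
      next
        case 3 then show ?thesis using ne unfolding 3 x by simp
      next
        case 4 then show ?thesis using ne unfolding 4 x by simp
      next
        case 5
        then have "i \<noteq> 0" "i \<noteq> 1" "i \<noteq> n - 2" "i \<noteq> n - 1" using n by auto
        then show ?thesis using xq[OF 5] q by (simp add: algebra_simps)
      qed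
    qed
    finally show ?thesis .
  qed
  moreover have "?x 0 \<noteq> 0" "0 < n" using x gamma_n_ge_2[OF n] n unfolding l_def by simp_all
  ultimately show ?thesis unfolding eigenpair_def l_def by blast
qed

section \<open>Transfer along switching isomorphisms\<close>

lemma eigenpair_switching_isomorphic:
  assumes iso: "switching_isomorphic n S T" and ev: "eigenpair n T e x"
  shows "\<exists>y. eigenpair n S e y"
proof -
  obtain p \<theta> where p: "bij_betw p {0..<n} {0..<n}" and t: "\<forall>i. \<theta> i \<in> {-1, 1::int}"
    and eq: "\<forall>i<n. \<forall>j<n. T (p i) (p j) = \<theta> i * S i j * \<theta> j"
    using iso unfolding switching_isomorphic_def by (elim exE conjE)
  have p: "bij_betw p {..<n} {..<n}" using p by (simp add: atLeast0LessThan)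
  have sg: "signs \<theta>" using t unfolding signs_def .
  define y where "y i = of_int (\<theta> i) * x (p i)" for i
  have row: "(\<Sum>j<n. of_int (S i j) * y j) = e * y i" if i: "i < n" for i
  proof -
    have "of_int (S i j) * y j = of_int (\<theta> i) * (of_int (T (p i) (p j)) * x (p j))" if j: "j < n" for j
    proof -
      have "\<theta> i * T (p i) (p j) = (\<theta> i * \<theta> i) * S i j * \<theta> j" using eq i j by simp
      then have "S i j * \<theta> j = \<theta> i * T (p i) (p j)" unfolding signsD(2)[OF sg] by simp
      then have "real_of_int (S i j) * of_int (\<theta> j) = of_int (\<theta> i) * of_int (T (p i) (p j))"
        by (metis of_int_mult)
      then show ?thesis unfolding y_def by (simp add: mult.assoc[symmetric])
    qed
    then have "(\<Sum>j<n. of_int (S i j) * y j) = of_int (\<theta> i) * (\<Sum>j<n. of_int (T (p i) (p j)) * x (p j))"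
      by (simp add: sum_distrib_left)
    also have "(\<Sum>j<n. of_int (T (p i) (p j)) * x (p j)) = (\<Sum>k<n. of_int (T (p i) k) * x k)"
      by (rule sum.reindex_bij_betw[OF p])
    also have "\<dots> = e * x (p i)" using ev bij_betwE[OF p] i unfolding eigenpair_def by auto
    finally show ?thesis unfolding y_def by simp
  qed
  obtain k where k: "k < n" "x k \<noteq> 0" using ev unfolding eigenpair_def by blast
  obtain i where i: "i < n" "p i = k" using p k(1) unfolding bij_betw_def by (metis imageE lessThan_iff)
  have "y i \<noteq> 0" unfolding y_def using i(2) k(2) signsD(1)[OF sg, of i] by auto
  then show ?thesis using row i(1) unfolding eigenpair_def by blast
qed

lemma ext_graph_relabel:
  assumes p: "inj_on p {..<n}" and l: "a < n" "b < n" "v1 < n" "v2 < n" "i < n" "j < n"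
  shows "ext_graph {p a} {p b} (p v1) (p v2) (p i) (p j) = ext_graph {a} {b} v1 v2 i j"
proof -
  have "p u = p v \<longleftrightarrow> u = v" if "u < n" "v < n" for u v
    using inj_on_eq_iff[OF p] that by simp
  then show ?thesis unfolding ext_graph_def Let_def using l by simp
qed

text \<open>The four special vertices are matched with 0, 1, n - 2, n - 1. The others all belong to
  \<open>C\<close> and are interchangeable, so any bijection between the complements extends the
  matching.\<close>

lemma switching_isomorphic_Gamma_nI:
  assumes n: "n \<ge> 6" and t: "signs \<theta>" and dist: "distinct [a, b, v1, v2]" and sub: "{a, b, v1, v2} \<subseteq> {..<n}"
    and eq: "\<forall>i<n. \<forall>j<n. switch \<theta> S i j = ext_graph {a} {b} v1 v2 i j"
  shows "switching_isomorphic n S (Gamma_n n)"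
proof -
  let ?D = "{a, b, v1, v2}" and ?E = "{0, 1, n - 2, n - 1}"
  have cD: "card ?D = 4" using dist by simp
  have "distinct [0, 1, n - 2, n - 1]" using n by auto
  from distinct_card[OF this] have cE: "card ?E = 4" by simp
  have subE: "?E \<subseteq> {..<n}" using n by auto
  have "card ({..<n} - ?D) = card ({..<n} - ?E)"
    using card_Diff_subset[OF _ sub] card_Diff_subset[OF _ subE] cD cE by simp
  then obtain q where q: "bij_betw q ({..<n} - ?D) ({..<n} - ?E)"
    using finite_same_card_bij[of "{..<n} - ?D" "{..<n} - ?E"] by auto
  define p where "p i = (if i = a then 0 else if i = b then 1 else if i = v1 then n - 2 else if i = v2 then n - 1 else q i)" for i
  have pv: "p a = 0" "p b = 1" "p v1 = n - 2" "p v2 = n - 1" using dist unfolding p_def by auto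
  have "bij_betw p ?D ?E" unfolding bij_betw_def inj_on_def using pv n by auto
  moreover have "bij_betw p ({..<n} - ?D) ({..<n} - ?E)"
    using q by (subst bij_betw_cong[of _ p q]) (auto simp: p_def)
  ultimately have "bij_betw p (?D \<union> ({..<n} - ?D)) (?E \<union> ({..<n} - ?E))"
    by (rule bij_betw_combine) blast
  moreover have "?D \<union> ({..<n} - ?D) = {..<n}" "?E \<union> ({..<n} - ?E) = {..<n}"
    by (rule Un_Diff_cancel[THEN trans], rule Un_absorb1, rule sub subE)+
  ultimately have p: "bij_betw p {..<n} {..<n}" by (simp only:)
  have "Gamma_n n (p i) (p j) = \<theta> i * S i j * \<theta> j" if ij: "i < n" "j < n" for i j
  proof -
    have "p i < n" "p j < n" using bij_betwE[OF p] ij by auto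
    then have "Gamma_n n (p i) (p j) = ext_graph {p a} {p b} (p v1) (p v2) (p i) (p j)"
      unfolding pv by (rule Gamma_n_eq_ext_graph[OF n])
    also have "\<dots> = ext_graph {a} {b} v1 v2 i j"
      using sub ij by (intro ext_graph_relabel[OF bij_betw_imp_inj_on[OF p]]) auto
    finally show ?thesis using eq ij unfolding switch_def by simp
  qed
  moreover have "\<forall>i. \<theta> i \<in> {-1, 1}" using t unfolding signs_def .
  ultimately show ?thesis using p unfolding switching_isomorphic_def atLeast0LessThan
    by (intro exI[of _ p] exI[of _ \<theta>]) simp
qed

theorem theorem1p1:
  fixes n :: nat and S :: "nat \<Rightarrow> nat \<Rightarrow> int"
  assumes "n \<ge> 6"
    and "signed_graph n S"
    and "\<not> balanced n S"
    and "\<forall>cs. negative_cycle n S cs \<longrightarrow> length cs \<noteq> 3 \<and> length cs \<noteq> 4"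
  shows "sg_spectral_radius n S \<le> gamma_n n \<and>
         (sg_spectral_radius n S = gamma_n n \<longleftrightarrow> switching_isomorphic n S (Gamma_n n))"
proof -
  have S: "no_short_neg n S" using assms(2,4) by (rule no_short_negI)
  have sym: "\<forall>i j. S i j = S j i" using signed_graphD(2)[OF assms(2)] by blast
  obtain e x where ev: "eigenpair n S e x" and e: "sg_spectral_radius n S = \<bar>e\<bar>"
    using sg_spectral_radius_attained[OF sym, of n] assms(1) by auto
  have qf: "qf n S x = e * (\<Sum>i<n. (x i)^2)"
  proof -
    have "qf n S x = (\<Sum>i<n. x i * (\<Sum>j<n. of_int (S i j) * x j))"
      unfolding qf_def by (simp add: sum_distrib_left mult_ac)
    also have "\<dots> = (\<Sum>i<n. x i * (e * x i))" using ev unfolding eigenpair_def by (intro sum.cong) auto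
    finally show ?thesis by (simp add: sum_distrib_left power2_eq_square mult_ac)
  qed
  obtain k where k: "k < n" "x k \<noteq> 0" using ev unfolding eigenpair_def by blast
  have "(\<Sum>i<n. (x i)^2) > 0" by (rule sum_pos2[of _ k]) (use k in auto)
  then have "e \<le> gamma_n n"
    using qf_le_gamma(1)[OF assms(1) S assms(3), of x] unfolding qf by simp
  moreover have lower: "- gamma_n n < e" by (rule eigenvalue_gt_neg_gamma[OF assms(1) S assms(3) ev])
  ultimately have le: "sg_spectral_radius n S \<le> gamma_n n" unfolding e by simp
  have "switching_isomorphic n S (Gamma_n n)" if "sg_spectral_radius n S = gamma_n n"
  proof -
    \<comment> \<open>The strict lower bound excludes \<open>e = - gamma_n n\<close>, so the
      equality case of the quadratic form applies.\<close>
    have "e = gamma_n n" using that lower unfolding e by (auto simp: abs_if split: if_splits)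
    then have "qf n S x = gamma_n n * (\<Sum>i<n. (x i)^2)" using qf by simp
    from qf_le_gamma(2)[OF assms(1) S assms(3) this k]
    show ?thesis using switching_isomorphic_Gamma_nI[OF assms(1)] by (elim exE conjE)
  qed
  \<comment> \<open>The eigenvalue of Gamma_n carries over to \<open>S\<close> and bounds its
    spectral radius from below; the upper bound is already available.\<close>
  moreover have "sg_spectral_radius n S = gamma_n n" if iso: "switching_isomorphic n S (Gamma_n n)"
  proof -
    obtain y where "eigenpair n S (gamma_n n) y"
      using eigenpair_switching_isomorphic[OF iso eigenpair_Gamma_n[OF assms(1)]] by (elim exE)
    from eigenpair_le_sg_spectral_radius[OF this] show ?thesis using le by simp
  qed
  ultimately show ?thesis using le by blast
qed

end
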